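(* Let $\check R_1$ be a Yang--Baxter operator on $V^{\pi_1}$, let $\Sigma_{\pi_2}$ be a connecting system for $\pi_2$, and let $j\in\Gamma(\pi\times\pi,\overline{\operatorname{Hom}}(V^{\pi_2}\otimes V^{\pi_2},V^{\pi_1}\otimes V^{\pi_1}))$ be right invertible. Suppose that the connecting system for $\pi_2$ is unique. If $j$ is a twist, then $(\check R_2)_\lhd$ is a Yang--Baxter operator on $V^{\pi_2}$.
   Context: The ground field is $k=\mathbb C$. $\pi_1,\pi_2$ are groupoids and $V^{\pi_i}=(V^{\pi_i}_\alpha)_{\alpha\in\pi_i}$ is a $\pi_i$-graded vector space of finite type: each $V^{\pi_i}_\alpha$ is finite dimensional, and for each object $a$ only finitely many arrows $\alpha$ with source or target $a$ have $V^{\pi_i}_\alpha\neq0$. Tensor products are $(V\otimes W)_\gamma=\bigoplus_{\beta\circ\alpha=\gamma}V_\alpha\otimes W_\beta$ ($\beta\circ\alpha$: first $\alpha$, then $\beta$); $\operatorname{End}$ denotes degree-preserving endomorphisms. A Yang--Baxter operator on $V$ is a meromorphic function $z\mapsto\check R(z)\in\operatorname{End}(V\otimes V)$ of $z\in\mathbb C$ satisfying the Yang--Baxter equation $\check R(z-w)^{(23)}\check R(z)^{(12)}\check R(w)^{(23)}=\check R(w)^{(12)}\check R(z)^{(23)}\check R(z-w)^{(12)}$ on $V^{\otimes 3}$ (superscripts: tensor factors acted on) and the inversion relation $\check R(z)\check R(-z)=\mathrm{id}_{V\otimes V}$. $\pi$ is a set with surjective maps $s_\pi:\pi\to\mathrm{Ob}(\pi_1)$,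 $t_\pi:\pi\to\mathrm{Ob}(\pi_2)$; its elements are viewed as arrows from $\pi_1$ to $\pi_2$. Transfer operators: for $V=(V^{\pi_1})^{\otimes m}$, $W=(V^{\pi_2})^{\otimes m}$, $\Gamma(\pi\times\pi,\overline{\operatorname{Hom}}(W,V))$ is the set of maps $g$ on $\pi\times\pi$ with $g(\beta_1,\beta_2)\in\bigoplus\operatorname{Hom}(W_\gamma,V_\alpha)$, over $\gamma\in\pi_2(t_\pi(\beta_1),t_\pi(\beta_2))$, $\alpha\in\pi_1(s_\pi(\beta_1),s_\pi(\beta_2))$, and $\Gamma(\pi\times\pi,\overline{\operatorname{Hom}}(V,W))$ is the set of maps $f$ with $f(\beta_1,\beta_2)\in\bigoplus\operatorname{Hom}(V_\alpha,W_\gamma)$, over $\alpha\in\pi_1(s_\pi(\beta_2),s_\pi(\beta_1))$, $\gamma\in\pi_2(t_\pi(\beta_2),t_\pi(\beta_1))$; in both cases, for every $\beta_1,\beta_2$ the number of $\alpha,\gamma$ is finite. An operator $Q\in\operatorname{End}(V)$ acts by $(Qg)(\beta_1,\beta_2)=Q\circ g(\beta_1,\beta_2)$. The map $g$ is right invertible with inverse $g^{-1}\in\Gamma(\pi\times\pi,\overline{\operatorname{Hom}}(V,W))$ if $(g*_\circ g^{-1})(\beta_1,\beta_2):=\sum_\beta g(\beta,\beta_2)g^{-1}(\beta_1,\beta)=\delta_{\beta_1,\beta_2}\mathrm{id}_{g^{-1}}(\beta_1,\beta_1)$ for $t_\pi(\beta_1)=t_\pi(\beta_2)$, where $\mathrm{id}_{g^{-1}}(\beta_1,\beta_1)$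 is the identity on $V_\alpha$ for any $V_\alpha$ that $g^{-1}$ transfers along $\beta_1$, i.e. on which $g^{-1}(\beta_1,\cdot)$ acts. Likewise $(g^{-1}*_\circ h)(\beta_1,\beta_2):=\sum_\beta g^{-1}(\beta,\beta_2)h(\beta_1,\beta)$ for $h\in\Gamma(\pi\times\pi,\overline{\operatorname{Hom}}(W,V))$ and $s_\pi(\beta_1)=s_\pi(\beta_2)$. In all these sums only composable components contribute. A connecting system for $\pi_2$ is a set $\Sigma_{\pi_2}\subset\pi$ such that for each path $\gamma$ in $\pi_2$ there is a unique $\beta_\gamma\in\Sigma_{\pi_2}$ with $t_\pi(\beta_\gamma)=s(\gamma)$, with $\beta_{\gamma\circ\gamma'}=\beta_{\gamma'}$, and each $\beta\in\Sigma_{\pi_2}$ equals $\beta_\gamma$ for at least one $\gamma$. It is unique if $s_\pi^{-1}(s_\pi(\beta_\gamma))=\{\beta_\gamma\}$ for all $\gamma$. For a family of operators $l(\beta,\beta)$, $\beta\in\Sigma_{\pi_2}$, where $l(\beta,\beta)$ acts on the part of $(V^{\pi_2})^{\otimes m}$ of source $t_\pi(\beta)$, $l_\lhd$ denotes the operator in $\operatorname{End}((V^{\pi_2})^{\otimes m})$ given on that part by $l(\beta,\beta)$. Given $j$ with right inverse $j^{-1}$, put, for $\beta_1\in\Sigma_{\pi_2}$, $\check R_2(\beta_1,\beta_1)=(j^{-1}*_\circ(\check R_1j))(\beta_1,\beta_1)=\sum_\beta j^{-1}(\beta,\beta_1)\check R_1j(\beta_1,\beta)$ (the dependence on the spectral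 parameter $z$ is suppressed); this gives $(\check R_2)_\lhd\in\operatorname{End}(V^{\pi_2}\otimes V^{\pi_2})$. The map $j$ is called a twist if there exists a right invertible $q\in\Gamma(\pi\times\pi,\overline{\operatorname{Hom}}((V^{\pi_2})^{\otimes3},(V^{\pi_1})^{\otimes3}))$ with $$\mathrm{id}_{V^{\pi_2}}\otimes(\check R_2)_\lhd=\big(q^{-1}*_\circ((\mathrm{id}_{V^{\pi_1}}\otimes\check R_1)q)\big)_\lhd,\qquad(\check R_2)_\lhd\otimes\mathrm{id}_{V^{\pi_2}}=\big(q^{-1}*_\circ((\check R_1\otimes\mathrm{id}_{V^{\pi_1}})q)\big)_\lhd.$$
   Formalization: The inversion relation can fail (V^{π1}=0, V^{π2}=ℂ, all maps 0). Proved: (Ř2)_⊲ is meromorphic, satisfies the Yang–Baxter equation, and is a Yang–Baxter operator iff (j⁻¹∗j)_⊲ = id. That (Ř2)_⊲ preserves degree, which is not automatic, is assumed. *)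

theory Defs
  imports
    "HOL-Complex_Analysis.Complex_Analysis"
    "HOL-Library.Function_Algebras"
begin

section \<open>Groupoids and graded vector spaces\<close>

record ('o, 'a) pre_groupoid =
  obj :: "'o set"
  arr :: "'a set"
  src :: "'a \<Rightarrow> 'o"
  tgt :: "'a \<Rightarrow> 'o"
  ident :: "'o \<Rightarrow> 'a"
  cmp :: "'a \<Rightarrow> 'a \<Rightarrow> 'a"  \<comment> \<open>\<open>cmp G \<beta> \<alpha>\<close> is \<open>\<beta> \<circ> \<alpha>\<close>: first \<open>\<alpha>\<close>, then \<open>\<beta>\<close>\<close>

locale groupoid =
  fixes G :: "('o, 'a, 'm) pre_groupoid_scheme"
  assumes src_obj: "\<alpha> \<in> arr G \<Longrightarrow> src G \<alpha> \<in> obj G"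
    and tgt_obj: "\<alpha> \<in> arr G \<Longrightarrow> tgt G \<alpha> \<in> obj G"
    and ident_arr: "a \<in> obj G \<Longrightarrow> ident G a \<in> arr G \<and> src G (ident G a) = a \<and> tgt G (ident G a) = a"
    and cmp_arr: "\<lbrakk>\<alpha> \<in> arr G; \<beta> \<in> arr G; tgt G \<alpha> = src G \<beta>\<rbrakk>
      \<Longrightarrow> cmp G \<beta> \<alpha> \<in> arr G \<and> src G (cmp G \<beta> \<alpha>) = src G \<alpha> \<and> tgt G (cmp G \<beta> \<alpha>) = tgt G \<beta>"
    and cmp_assoc: "\<lbrakk>\<alpha> \<in> arr G; \<beta> \<in> arr G; \<gamma> \<in> arr G; tgt G \<alpha> = src G \<beta>; tgt G \<beta> = src G \<gamma>\<rbrakk>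
      \<Longrightarrow> cmp G \<gamma> (cmp G \<beta> \<alpha>) = cmp G (cmp G \<gamma> \<beta>) \<alpha>"
    and cmp_ident: "\<alpha> \<in> arr G
      \<Longrightarrow> cmp G \<alpha> (ident G (src G \<alpha>)) = \<alpha> \<and> cmp G (ident G (tgt G \<alpha>)) \<alpha> = \<alpha>"
    and inverse: "\<alpha> \<in> arr G
      \<Longrightarrow> \<exists>\<beta>\<in>arr G. src G \<beta> = tgt G \<alpha> \<and> tgt G \<beta> = src G \<alpha> \<and>
            cmp G \<beta> \<alpha> = ident G (src G \<alpha>) \<and> cmp G \<alpha> \<beta> = ident G (tgt G \<alpha>)"

definition homset :: "('o, 'a, 'm) pre_groupoid_scheme \<Rightarrow> 'o \<Rightarrow> 'o \<Rightarrow> 'a set" where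
  "homset G a b = {\<alpha> \<in> arr G. src G \<alpha> = a \<and> tgt G \<alpha> = b}"

text \<open>All homogeneous pieces are finite-dimensional subspaces of one complex vector space, which is
  the type \<open>'v\<close> with scalar multiplication \<open>scal\<close>. The pieces are only ever used as a family, so
  nothing is assumed about their relative position.\<close>

record ('o, 'a, 'v) graded = "('o, 'a) pre_groupoid" +
  scal :: "complex \<Rightarrow> 'v \<Rightarrow> 'v"
  piece :: "'a \<Rightarrow> 'v set"

locale graded_space = groupoid V
  for V :: "('o, 'a, 'v::ab_group_add) graded" +
  assumes vs: "vector_space (scal V)"
    and piece_subspace: "\<alpha> \<in> arr V \<Longrightarrow> module.subspace (scal V) (piece V \<alpha>)"
    and piece_finite_dim: "\<alpha> \<in> arr V \<Longrightarrow> \<exists>B. finite B \<and> piece V \<alpha> = module.span (scal V) B"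
    and finite_type: "a \<in> obj V
      \<Longrightarrow> finite {\<alpha> \<in> arr V. (src V \<alpha> = a \<or> tgt V \<alpha> = a) \<and> piece V \<alpha> \<noteq> {0}}"


section \<open>Tensor powers\<close>

text \<open>The tensor product of vector spaces \<open>U\<^sub>1, \<dots>, U\<^sub>m\<close> is realised as the span of the
  elementary tensors inside the functions on \<open>m\<close>-tuples of linear functionals, where
  \<open>(u\<^sub>1 \<otimes> \<dots> \<otimes> u\<^sub>m) (\<phi>\<^sub>1, \<dots>, \<phi>\<^sub>m) = \<phi>\<^sub>1 u\<^sub>1 \<cdots> \<phi>\<^sub>m u\<^sub>m\<close>. (Over a field the canonical
  map from the tensor product to this function space is injective.) To take the direct sum over
  all factorisations of the degree, the arguments also carry a list of arrows: the summand
  \<open>V\<^bsub>\<alpha>\<^sub>1\<^esub> \<otimes> \<dots> \<otimes> V\<^bsub>\<alpha>\<^sub>m\<^esub>\<close> consists of functions supported on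
  lists with first components \<open>[\<alpha>\<^sub>1, \<dots>, \<alpha>\<^sub>m]\<close>.\<close>

type_synonym ('a, 'v) tensor = "('a \<times> ('v \<Rightarrow> complex)) list \<Rightarrow> complex"

definition tscale :: "complex \<Rightarrow> ('x \<Rightarrow> complex) \<Rightarrow> 'x \<Rightarrow> complex" where
  "tscale c t = (\<lambda>x. c * t x)"

definition elem_tensor :: "('o, 'a, 'v::ab_group_add) graded \<Rightarrow> ('a \<times> 'v) list \<Rightarrow> ('a, 'v) tensor" where
  "elem_tensor V us = (\<lambda>xs.
     if map fst xs = map fst us \<and> (\<forall>\<phi>\<in>set (map snd xs). Vector_Spaces.linear (scal V) (*) \<phi>)
     then \<Prod>i<length us. snd (xs ! i) (snd (us ! i)) else 0)"

definition is_path :: "('o, 'a, 'm) pre_groupoid_scheme \<Rightarrow> 'a list \<Rightarrow> bool" where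
  "is_path G as \<longleftrightarrow> as \<noteq> [] \<and> set as \<subseteq> arr G \<and> successively (\<lambda>\<alpha> \<beta>. tgt G \<alpha> = src G \<beta>) as"

text \<open>The composite of the path \<open>[\<alpha>\<^sub>1, \<dots>, \<alpha>\<^sub>m]\<close> is \<open>\<alpha>\<^sub>m \<circ> \<dots> \<circ> \<alpha>\<^sub>1\<close>.\<close>

fun composite :: "('o, 'a, 'm) pre_groupoid_scheme \<Rightarrow> 'a list \<Rightarrow> 'a" where
  "composite G [] = undefined"
| "composite G [\<alpha>] = \<alpha>"
| "composite G (\<alpha> # \<beta> # as) = cmp G (composite G (\<beta> # as)) \<alpha>"

text \<open>\<open>tpow V m A\<close> is the direct sum of the \<open>(V\<^bsup>\<otimes>m\<^esup>)\<^sub>\<gamma>\<close> over \<open>\<gamma> \<in> A\<close>, for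
  \<open>m \<ge> 1\<close>. So \<open>tpow V m {\<gamma>}\<close> is the piece of degree \<open>\<gamma>\<close> and \<open>tpow V m (arr V)\<close> the whole
  space.\<close>

definition tpow :: "('o, 'a, 'v::ab_group_add) graded \<Rightarrow> nat \<Rightarrow> 'a set \<Rightarrow> ('a, 'v) tensor set" where
  "tpow V m A = module.span tscale
     {elem_tensor V us | us. length us = m \<and> is_path V (map fst us) \<and>
        composite V (map fst us) \<in> A \<and> (\<forall>(\<alpha>, u)\<in>set us. u \<in> piece V \<alpha>)}"

definition src_arrows :: "('o, 'a, 'm) pre_groupoid_scheme \<Rightarrow> 'o \<Rightarrow> 'a set" where
  "src_arrows G a = {\<alpha> \<in> arr G. src G \<alpha> = a}"

text \<open>Linear maps between subspaces of function spaces; the values off \<open>S\<close> are irrelevant.\<close>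

definition linear_map :: "('x \<Rightarrow> complex) set \<Rightarrow> ('y \<Rightarrow> complex) set \<Rightarrow>
    (('x \<Rightarrow> complex) \<Rightarrow> ('y \<Rightarrow> complex)) \<Rightarrow> bool" where
  "linear_map S T f \<longleftrightarrow> (\<forall>u\<in>S. f u \<in> T) \<and> (\<forall>u\<in>S. \<forall>v\<in>S. f (u + v) = f u + f v) \<and>
     (\<forall>c. \<forall>u\<in>S. f (tscale c u) = tscale c (f u))"

definition linear_form :: "('x \<Rightarrow> complex) set \<Rightarrow> (('x \<Rightarrow> complex) \<Rightarrow> complex) \<Rightarrow> bool" where
  "linear_form S \<phi> \<longleftrightarrow> (\<forall>u\<in>S. \<forall>v\<in>S. \<phi> (u + v) = \<phi> u + \<phi> v) \<and>
     (\<forall>c. \<forall>u\<in>S. \<phi> (tscale c u) = c * \<phi> u)"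

text \<open>Degree-preserving endomorphisms of \<open>V\<^bsup>\<otimes>m\<^esup>\<close>.\<close>

definition End_tpow :: "('o, 'a, 'v::ab_group_add) graded \<Rightarrow> nat \<Rightarrow>
    (('a, 'v) tensor \<Rightarrow> ('a, 'v) tensor) set" where
  "End_tpow V m = {Q. linear_map (tpow V m (arr V)) (tpow V m (arr V)) Q \<and>
     (\<forall>\<gamma>\<in>arr V. \<forall>t\<in>tpow V m {\<gamma>}. Q t \<in> tpow V m {\<gamma>})}"

text \<open>For \<open>Q\<close> acting on \<open>V \<otimes> V\<close>, the operators \<open>Q \<otimes> id\<close> and \<open>id \<otimes> Q\<close> on
  \<open>V \<otimes> V \<otimes> V\<close>: fix the argument of a tensor in the idle factor and apply \<open>Q\<close> to the function
  of the other two arguments. The lemmas below give the values on \<open>u \<otimes> w\<close>.\<close>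

definition leg12 :: "(('a, 'v) tensor \<Rightarrow> ('a, 'v) tensor) \<Rightarrow> ('a, 'v) tensor \<Rightarrow> ('a, 'v) tensor" where
  "leg12 Q t = (\<lambda>xs. if length xs = 3 then Q (\<lambda>ys. t (ys @ drop 2 xs)) (take 2 xs) else 0)"

definition leg23 :: "(('a, 'v) tensor \<Rightarrow> ('a, 'v) tensor) \<Rightarrow> ('a, 'v) tensor \<Rightarrow> ('a, 'v) tensor" where
  "leg23 Q t = (\<lambda>xs. if length xs = 3 then Q (\<lambda>ys. t (take 1 xs @ ys)) (drop 1 xs) else 0)"

lemma leg12_tensor:
  assumes Q: "linear_map S T Q" and u: "u \<in> S"
    and u0: "\<And>xs. length xs \<noteq> 2 \<Longrightarrow> u xs = 0" and w0: "\<And>xs. length xs \<noteq> 1 \<Longrightarrow> w xs = 0"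
    and xs: "length xs = 3"
  shows "leg12 Q (\<lambda>xs. u (take 2 xs) * w (drop 2 xs)) xs = Q u (take 2 xs) * w (drop 2 xs)"
proof -
  have "(\<lambda>ys. u (take 2 (ys @ drop 2 xs)) * w (drop 2 (ys @ drop 2 xs))) = tscale (w (drop 2 xs)) u"
  proof
    fix ys :: "('a \<times> ('b \<Rightarrow> complex)) list"
    show "u (take 2 (ys @ drop 2 xs)) * w (drop 2 (ys @ drop 2 xs)) = tscale (w (drop 2 xs)) u ys"
      using xs u0[of ys] w0[of "drop 2 (ys @ drop 2 xs)"]
      by (cases "length ys = 2") (auto simp: tscale_def)
  qed
  then show ?thesis using Q u xs by (simp add: leg12_def linear_map_def) (simp add: tscale_def)
qed

lemma leg23_tensor:
  assumes Q: "linear_map S T Q" and u: "u \<in> S"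
    and u0: "\<And>xs. length xs \<noteq> 2 \<Longrightarrow> u xs = 0"
    and xs: "length xs = 3"
  shows "leg23 Q (\<lambda>xs. w (take 1 xs) * u (drop 1 xs)) xs = w (take 1 xs) * Q u (drop 1 xs)"
proof -
  have "(\<lambda>ys. w (take 1 (take 1 xs @ ys)) * u (drop 1 (take 1 xs @ ys))) = tscale (w (take 1 xs)) u"
    using xs by (auto simp: tscale_def fun_eq_iff)
  then show ?thesis using Q u xs by (simp add: leg23_def linear_map_def) (simp add: tscale_def)
qed


section \<open>Yang--Baxter operators\<close>

text \<open>An \<open>End\<close>-valued meromorphic function is represented by a function defined at every \<open>z\<close>, whose
  values at the poles are arbitrary elements of \<open>End\<close>. Each degree piece is finite-dimensional and
  meromorphy is imposed on the matrix coefficients there; the set of poles may depend on the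
  degree.\<close>

definition meromorphic_End :: "('o, 'a, 'v::ab_group_add) graded \<Rightarrow>
    (complex \<Rightarrow> ('a, 'v) tensor \<Rightarrow> ('a, 'v) tensor) \<Rightarrow> bool" where
  "meromorphic_End V R \<longleftrightarrow> (\<forall>z. R z \<in> End_tpow V 2) \<and>
     (\<forall>\<gamma>\<in>arr V. \<forall>t\<in>tpow V 2 {\<gamma>}. \<forall>\<phi>. linear_form (tpow V 2 {\<gamma>}) \<phi> \<longrightarrow>
        (\<lambda>z. \<phi> (R z t)) meromorphic_on UNIV)"

text \<open>Identities between meromorphic functions hold, in each degree, away from a closed discrete set
  of exceptional values of the spectral parameters.\<close>

definition yang_baxter_equation :: "('o, 'a, 'v::ab_group_add) graded \<Rightarrow>
    (complex \<Rightarrow> ('a, 'v) tensor \<Rightarrow> ('a, 'v) tensor) \<Rightarrow> bool" where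
  "yang_baxter_equation V R \<longleftrightarrow>
     (\<forall>\<gamma>\<in>arr V. \<exists>E. E sparse_in UNIV \<and>
        (\<forall>z w. z \<notin> E \<and> w \<notin> E \<and> z - w \<notin> E \<longrightarrow>
          (\<forall>t\<in>tpow V 3 {\<gamma>}.
             leg23 (R (z - w)) (leg12 (R z) (leg23 (R w) t)) =
             leg12 (R w) (leg23 (R z) (leg12 (R (z - w)) t)))))"

definition inversion_relation :: "('o, 'a, 'v::ab_group_add) graded \<Rightarrow>
    (complex \<Rightarrow> ('a, 'v) tensor \<Rightarrow> ('a, 'v) tensor) \<Rightarrow> bool" where
  "inversion_relation V R \<longleftrightarrow>
     (\<forall>\<gamma>\<in>arr V. \<forall>\<^sub>F z in cosparse UNIV. \<forall>t\<in>tpow V 2 {\<gamma>}. R z (R (- z) t) = t)"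

definition yang_baxter_operator :: "('o, 'a, 'v::ab_group_add) graded \<Rightarrow>
    (complex \<Rightarrow> ('a, 'v) tensor \<Rightarrow> ('a, 'v) tensor) \<Rightarrow> bool" where
  "yang_baxter_operator V R \<longleftrightarrow>
     meromorphic_End V R \<and> yang_baxter_equation V R \<and> inversion_relation V R"


section \<open>Transfer operators\<close>

text \<open>Elements of the direct sum of the \<open>Hom((A\<^bsup>\<otimes>m\<^esup>)\<^sub>\<gamma>, (B\<^bsup>\<otimes>m\<^esup>)\<^sub>\<alpha>)\<close> over \<open>\<gamma> : a \<rightarrow> a'\<close> and
  \<open>\<alpha> : b \<rightarrow> b'\<close>, extended by zero to the other pieces of \<open>A\<^bsup>\<otimes>m\<^esup>\<close>. With this convention
  non-composable components drop out of ordinary compositions. By finite type, only finitely many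
  \<open>\<gamma>\<close> and \<open>\<alpha>\<close> matter.\<close>

definition transfer_Hom :: "nat \<Rightarrow> ('o, 'a, 'v::ab_group_add) graded \<Rightarrow> 'o \<Rightarrow> 'o \<Rightarrow>
    ('p, 'b, 'w::ab_group_add) graded \<Rightarrow> 'p \<Rightarrow> 'p \<Rightarrow> (('a, 'v) tensor \<Rightarrow> ('b, 'w) tensor) set" where
  "transfer_Hom m A a a' B b b' =
     {h. linear_map (tpow A m (arr A)) (tpow B m (homset B b b')) h \<and>
         (\<forall>\<gamma>\<in>arr A - homset A a a'. \<forall>u\<in>tpow A m {\<gamma>}. h u = 0)}"

text \<open>\<open>Gamma_WV\<close> and \<open>Gamma_VW\<close> are \<open>\<Gamma>(\<pi> \<times> \<pi>, Hom(W, V))\<close> and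
  \<open>\<Gamma>(\<pi> \<times> \<pi>, Hom(V, W))\<close> for \<open>V = (V\<^sub>1)\<^bsup>\<otimes>m\<^esup>\<close> and \<open>W = (V\<^sub>2)\<^bsup>\<otimes>m\<^esup>\<close>, where \<open>P\<close> is
  the set \<open>\<pi>\<close> with its maps \<open>s\<close>, \<open>t\<close>. The second has the arguments \<open>\<beta>\<^sub>1, \<beta>\<^sub>2\<close> in the reversed order.\<close>

definition Gamma_WV where
  "Gamma_WV P s t m V1 V2 =
     {g. \<forall>\<beta>\<^sub>1\<in>P. \<forall>\<beta>\<^sub>2\<in>P. g \<beta>\<^sub>1 \<beta>\<^sub>2 \<in> transfer_Hom m V2 (t \<beta>\<^sub>1) (t \<beta>\<^sub>2) V1 (s \<beta>\<^sub>1) (s \<beta>\<^sub>2)}"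

definition Gamma_VW where
  "Gamma_VW P s t m V1 V2 =
     {f. \<forall>\<beta>\<^sub>1\<in>P. \<forall>\<beta>\<^sub>2\<in>P. f \<beta>\<^sub>1 \<beta>\<^sub>2 \<in> transfer_Hom m V1 (s \<beta>\<^sub>2) (s \<beta>\<^sub>1) V2 (t \<beta>\<^sub>2) (t \<beta>\<^sub>1)}"

text \<open>The sum over \<open>\<beta> \<in> P\<close> of \<open>f(\<beta>, \<beta>\<^sub>2) h(\<beta>\<^sub>1, \<beta>)\<close>, evaluated at \<open>u\<close>; it is meant for the case
  that only finitely many terms are nonzero at \<open>u\<close>.\<close>

definition star :: "'p set \<Rightarrow> ('p \<Rightarrow> 'p \<Rightarrow> ('y \<Rightarrow> complex) \<Rightarrow> ('z \<Rightarrow> complex)) \<Rightarrow>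
    ('p \<Rightarrow> 'p \<Rightarrow> ('x \<Rightarrow> complex) \<Rightarrow> ('y \<Rightarrow> complex)) \<Rightarrow>
    'p \<Rightarrow> 'p \<Rightarrow> ('x \<Rightarrow> complex) \<Rightarrow> ('z \<Rightarrow> complex)" where
  "star P f h \<beta>\<^sub>1 \<beta>\<^sub>2 u = (\<Sum>\<beta> | \<beta> \<in> P \<and> f \<beta> \<beta>\<^sub>2 (h \<beta>\<^sub>1 \<beta> u) \<noteq> 0. f \<beta> \<beta>\<^sub>2 (h \<beta>\<^sub>1 \<beta> u))"

text \<open>The arrows \<open>\<alpha>\<close> such that \<open>V\<^sub>\<alpha>\<close> is one of the spaces on which \<open>g\<inverse>(\<beta>\<^sub>1, \<cdot>)\<close> acts: \<open>\<alpha>\<close> is an index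
  of the direct sum containing \<open>g\<inverse>(\<beta>\<^sub>1, \<beta>)\<close> for some \<open>\<beta>\<close>.\<close>

definition transferred where
  "transferred P s t V1 V2 \<beta>\<^sub>1 =
     {\<alpha>. \<exists>\<beta>\<in>P. \<alpha> \<in> homset V1 (s \<beta>) (s \<beta>\<^sub>1) \<and> homset V2 (t \<beta>) (t \<beta>\<^sub>1) \<noteq> {}}"

definition right_inverse where
  "right_inverse P s t m V1 V2 g g' \<longleftrightarrow>
     g \<in> Gamma_WV P s t m V1 V2 \<and> g' \<in> Gamma_VW P s t m V1 V2 \<and>
     (\<forall>\<beta>\<^sub>1\<in>P. \<forall>\<beta>\<^sub>2\<in>P. t \<beta>\<^sub>1 = t \<beta>\<^sub>2 \<longrightarrow>
        (\<forall>\<alpha>\<in>transferred P s t V1 V2 \<beta>\<^sub>1. \<forall>u\<in>tpow V1 m {\<alpha>}.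
           finite {\<beta> \<in> P. g \<beta> \<beta>\<^sub>2 (g' \<beta>\<^sub>1 \<beta> u) \<noteq> 0} \<and>
           star P g g' \<beta>\<^sub>1 \<beta>\<^sub>2 u = (if \<beta>\<^sub>1 = \<beta>\<^sub>2 then u else 0)))"


section \<open>Connecting systems and twists\<close>

text \<open>\<open>connect V2 t S \<gamma>\<close> is \<open>\<beta>\<^sub>\<gamma>\<close>.\<close>

definition connect :: "('o, 'a, 'm) pre_groupoid_scheme \<Rightarrow> ('p \<Rightarrow> 'o) \<Rightarrow> 'p set \<Rightarrow> 'a \<Rightarrow> 'p" where
  "connect G t S \<gamma> = (THE \<beta>. \<beta> \<in> S \<and> t \<beta> = src G \<gamma>)"

definition connecting_system :: "'p set \<Rightarrow> ('p \<Rightarrow> 'o) \<Rightarrow> ('o, 'a, 'm) pre_groupoid_scheme \<Rightarrow>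
    'p set \<Rightarrow> bool" where
  "connecting_system P t G S \<longleftrightarrow> S \<subseteq> P \<and>
     (\<forall>\<gamma>\<in>arr G. \<exists>!\<beta>. \<beta> \<in> S \<and> t \<beta> = src G \<gamma>) \<and>
     (\<forall>\<gamma>\<in>arr G. \<forall>\<gamma>'\<in>arr G. tgt G \<gamma>' = src G \<gamma> \<longrightarrow>
        connect G t S (cmp G \<gamma> \<gamma>') = connect G t S \<gamma>') \<and>
     (\<forall>\<beta>\<in>S. \<exists>\<gamma>\<in>arr G. \<beta> = connect G t S \<gamma>)"

definition unique_connecting_system :: "'p set \<Rightarrow> ('p \<Rightarrow> 'o1) \<Rightarrow> ('p \<Rightarrow> 'o) \<Rightarrow>
    ('o, 'a, 'm) pre_groupoid_scheme \<Rightarrow> 'p set \<Rightarrow> bool" where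
  "unique_connecting_system P s t G S \<longleftrightarrow> connecting_system P t G S \<and>
     (\<forall>\<gamma>\<in>arr G. {\<beta> \<in> P. s \<beta> = s (connect G t S \<gamma>)} = {connect G t S \<gamma>})"

definition source_part :: "('o, 'a, 'm) pre_groupoid_scheme \<Rightarrow> 'o \<Rightarrow> ('a, 'v) tensor \<Rightarrow>
    ('a, 'v) tensor" where
  "source_part G a u =
     (\<lambda>xs. if xs \<noteq> [] \<and> fst (hd xs) \<in> arr G \<and> src G (fst (hd xs)) = a then u xs else 0)"

text \<open>The operator \<open>l\<^sub>\<lhd>\<close>, where \<open>l \<beta>\<close> stands for \<open>l(\<beta>, \<beta>)\<close>: it applies \<open>l \<beta>\<close> to the part of source
  \<open>t \<beta>\<close>, for each \<open>\<beta> \<in> S\<close>. As \<open>l \<beta>\<close> maps this part to itself, the value of the result at an argument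
  whose first arrow is \<open>\<gamma>\<close> comes from \<open>\<beta> = \<beta>\<^sub>\<gamma>\<close>.\<close>

definition lhd :: "('o, 'a, 'm) pre_groupoid_scheme \<Rightarrow> ('p \<Rightarrow> 'o) \<Rightarrow> 'p set \<Rightarrow>
    ('p \<Rightarrow> ('a, 'v) tensor \<Rightarrow> ('a, 'v) tensor) \<Rightarrow> ('a, 'v) tensor \<Rightarrow> ('a, 'v) tensor" where
  "lhd G t S l u =
     (\<lambda>xs. if xs \<noteq> [] \<and> fst (hd xs) \<in> arr G
       then l (connect G t S (fst (hd xs))) (source_part G (src G (fst (hd xs))) u) xs else 0)"

text \<open>\<open>conj_lhd P t S V2 g' Q g\<close> is \<open>(g\<inverse> *\<^sub>\<circ> (Q g))\<^sub>\<lhd>\<close>.\<close>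

definition conj_lhd where
  "conj_lhd P t S V2 g' Q g = lhd V2 t S (\<lambda>\<beta>. star P g' (\<lambda>\<beta>\<^sub>1 \<beta>\<^sub>2. Q \<circ> g \<beta>\<^sub>1 \<beta>\<^sub>2) \<beta> \<beta>)"

text \<open>The twist condition for the right inverse \<open>j'\<close> of \<open>j\<close>. The transfer operators
  \<open>j\<close>, \<open>q\<close> and their inverses do not depend on the spectral parameter.\<close>

definition is_twist where
  "is_twist P s t S V1 V2 R1 j j' \<longleftrightarrow>
     (\<exists>q q'. right_inverse P s t 3 V1 V2 q q' \<and>
        (\<forall>\<gamma>\<in>arr V2. \<forall>\<^sub>F z in cosparse UNIV. \<forall>u\<in>tpow V2 3 {\<gamma>}.
           leg23 (conj_lhd P t S V2 j' (R1 z) j) u = conj_lhd P t S V2 q' (leg23 (R1 z)) q u \<and>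
           leg12 (conj_lhd P t S V2 j' (R1 z) j) u = conj_lhd P t S V2 q' (leg12 (R1 z)) q u))"

end

theory Submission
  imports Defs
begin

text \<open>
  Let \<open>\<beta>\<close> be the element of the connecting system over an object \<open>b\<close> of the second groupoid. On
  tensors of source \<open>b\<close>, the operator \<open>(g\<inverse> *\<^sub>\<circ> (Q g))\<^sub>\<lhd>\<close> is the sum over \<open>\<beta>' \<in> P\<close> of
  \<open>g\<inverse>(\<beta>', \<beta>) Q g(\<beta>, \<beta>')\<close>. Right invertibility of \<open>g\<close> is a statement about sums of products
  \<open>g(b', \<cdot>) g\<inverse>(\<cdot>, b')\<close> over all \<open>b'\<close> with a given source. Uniqueness of the connecting system says
  that \<open>\<beta>\<close> is the only element of \<open>P\<close> with its source, so that this sum has a single term: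
  \<open>g(\<beta>, \<beta>') g\<inverse>(\<beta>'', \<beta>) = \<delta> id\<close> for \<open>\<beta>'\<close>, \<open>\<beta>''\<close> with the same target (lemma \<open>g_g'\<close>). Consequently conjugation
  \<open>Q \<mapsto> (g\<inverse> *\<^sub>\<circ> (Q g))\<^sub>\<lhd>\<close> is multiplicative on degree-preserving operators (lemma \<open>Conj_comp\<close>), but the
  identity goes to an idempotent that may differ from the identity.

  The Yang--Baxter equation follows: by the twist condition both legs of \<open>R2\<close> on the tensor cube are
  conjugates by \<open>q\<close> of the corresponding legs of \<open>R1\<close>, so both sides of the equation for \<open>R2\<close> are
  conjugates of the two sides for \<open>R1\<close>. In the same way \<open>R2(z) R2(-z)\<close> is the conjugate by \<open>j\<close> of
  \<open>R1(z) R1(-z) = id\<close>. Hence the inversion relation for \<open>R2\<close> holds exactly when conjugation by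
  \<open>j\<close> preserves the identity.

  Three points need care. The sum over \<open>\<beta>'\<close> is finite at each vector, because its
  nonzero terms with \<open>Q = id\<close> are linearly independent by the relation above and lie in the
  finite-dimensional space of tensors of source \<open>b\<close> (lemma \<open>finite_support\<close>). The exceptional
  parameters for \<open>R1\<close> depend on the degree, but only finitely many degrees with a given source carry
  nonzero tensors (lemma \<open>tpow_src_arrows_support\<close>). Finally, single terms of the sum need not be
  homogeneous, even though their sum is; for the meromorphy of \<open>R2\<close>, a linear form on one degree is
  therefore extended by the projection to that degree (lemma \<open>meromorphic_local_conj\<close>).
\<close>

section \<open>Linear algebra in the tensor powers\<close>

text \<open>Unfolding sums and zeros of functions pointwise would hide them from the vector space laws and
  from linearity, so pointwise evaluation is invoked explicitly where it is wanted.\<close>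

declare plus_fun_apply [simp del] zero_fun_apply [simp del]

interpretation fun_vs: vector_space tscale
  by unfold_locales (auto simp: tscale_def fun_eq_iff plus_fun_apply algebra_simps)

lemma subspace_tpow: "fun_vs.subspace (tpow V m A)"
  unfolding tpow_def by (rule fun_vs.subspace_span)

lemmas tpow_zero = fun_vs.subspace_0[OF subspace_tpow]
  and tpow_add = fun_vs.subspace_add[OF subspace_tpow]
  and tpow_scale = fun_vs.subspace_scale[OF subspace_tpow]
  and tpow_sum = fun_vs.subspace_sum[OF subspace_tpow]

lemma tpow_mono: "A \<subseteq> B \<Longrightarrow> tpow V m A \<subseteq> tpow V m B"
  unfolding tpow_def by (rule fun_vs.span_mono) blast

lemma elem_tensor_in_tpow:
  assumes "length us = m" "is_path V (map fst us)" "composite V (map fst us) \<in> A"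
    and "\<And>\<alpha> u. (\<alpha>, u) \<in> set us \<Longrightarrow> u \<in> piece V \<alpha>"
  shows "elem_tensor V us \<in> tpow V m A"
  unfolding tpow_def by (rule fun_vs.span_base) (use assms in blast)

lemma tpow_induct [consumes 1, case_names zero elem add]:
  assumes "u \<in> tpow V m A"
    and "P 0"
    and "\<And>us. length us = m \<Longrightarrow> is_path V (map fst us) \<Longrightarrow> composite V (map fst us) \<in> A \<Longrightarrow>
      (\<forall>(\<alpha>, u)\<in>set us. u \<in> piece V \<alpha>) \<Longrightarrow> P (elem_tensor V us)"
    and "\<And>c u v. u \<in> tpow V m A \<Longrightarrow> v \<in> tpow V m A \<Longrightarrow> P u \<Longrightarrow> P v \<Longrightarrow> P (tscale c u + v)"
  shows "P u"
proof -
  have "u \<in> tpow V m A \<and> P u"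
    using assms(1) unfolding tpow_def
  proof (induction rule: fun_vs.span_induct_alt)
    case base
    then show ?case using assms(2) tpow_zero[of V m A] by (simp add: tpow_def)
  next
    case (step c x y)
    then have x: "P x" "x \<in> tpow V m A" using assms(3) by (auto intro: elem_tensor_in_tpow)
    have "tscale c x \<in> tpow V m A" by (rule tpow_scale) (rule x)
    with step x show ?case using assms(4)[of x y c] tpow_add[of "tscale c x" V m A y] by (simp add: tpow_def)
  qed
  then show ?thesis by simp
qed

text \<open>Each generator has a degree in \<open>A\<close>, so the induction can start from all tensors of one degree;
  only sums then remain, scalars being absorbed into the homogeneous case.\<close>

lemma tpow_induct_degree [consumes 1, case_names zero homogeneous add]:
  assumes "u \<in> tpow V m A"
    and "P 0"
    and "\<And>\<gamma> u. \<gamma> \<in> A \<Longrightarrow> u \<in> tpow V m {\<gamma>} \<Longrightarrow> P u"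
    and "\<And>u v. u \<in> tpow V m A \<Longrightarrow> v \<in> tpow V m A \<Longrightarrow> P u \<Longrightarrow> P v \<Longrightarrow> P (u + v)"
  shows "P u"
proof -
  have "P u \<and> (\<forall>c. P (tscale c u))" using assms(1)
  proof (induction rule: tpow_induct)
    case zero
    have "tscale c (0 :: 'c \<Rightarrow> complex) = 0" for c by (simp add: tscale_def fun_eq_iff zero_fun_apply)
    then show ?case using assms(2) by (simp add: fun_vs.scale_zero_right)
  next
    case (elem us)
    then have "elem_tensor V us \<in> tpow V m {composite V (map fst us)}"
      by (intro elem_tensor_in_tpow) auto
    then show ?case using assms(3)[OF elem(3)] tpow_scale by blast
  next
    case (add c u v)
    have "P (tscale d (tscale c u + v))" for d
    proof -
      have "tscale d (tscale c u + v) = tscale (d * c) u + tscale d v"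
        by (simp add: tscale_def fun_eq_iff plus_fun_apply algebra_simps)
      then show ?thesis
        using assms(4)[OF tpow_scale[OF add(1)] tpow_scale[OF add(2)]] add(3,4) by metis
    qed
    moreover have "P (tscale c u + v)"
      using assms(4)[OF tpow_scale[OF add(1)] add(2)] add(3,4) by blast
    ultimately show ?case by blast
  qed
  then show ?thesis by simp
qed

lemma linear_map_zero: "linear_map S T f \<Longrightarrow> fun_vs.subspace S \<Longrightarrow> f 0 = 0"
proof -
  assume f: "linear_map S T f" and S: "fun_vs.subspace S"
  have "f (tscale 0 0) = tscale 0 (f 0)" 
    using f fun_vs.subspace_0[OF S] unfolding linear_map_def by blast
  then show ?thesis by (simp add: fun_vs.scale_zero_left)
qed

lemma linear_map_add: "linear_map S T f \<Longrightarrow> u \<in> S \<Longrightarrow> v \<in> S \<Longrightarrow> f (u + v) = f u + f v"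
  and linear_map_scale: "linear_map S T f \<Longrightarrow> u \<in> S \<Longrightarrow> f (tscale c u) = tscale c (f u)"
  and linear_map_in: "linear_map S T f \<Longrightarrow> u \<in> S \<Longrightarrow> f u \<in> T"
  unfolding linear_map_def by blast+

lemma linear_map_sum:
  assumes f: "linear_map S T f" and S: "fun_vs.subspace S" and x: "\<And>i. i \<in> I \<Longrightarrow> x i \<in> S"
  shows "f (sum x I) = (\<Sum>i\<in>I. f (x i))"
  using x
proof (induction I rule: infinite_finite_induct)
  case (insert i I)
  then show ?case using linear_map_add[OF f] fun_vs.subspace_sum[OF S, of I x] by simp
qed (simp_all add: linear_map_zero[OF f S])

text \<open>If \<open>f i\<close> kills every \<open>x k\<close> but \<open>x i\<close>, it kills their span, so \<open>x i\<close> lies outside it. Hence the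
  \<open>x i\<close> are distinct and linearly independent, and a finitely spanned space has room for only
  finitely many of them.\<close>

lemma finite_dual_system:
  assumes B: "finite B" and x: "\<And>i. i \<in> I \<Longrightarrow> x i \<in> fun_vs.span B"
    and f: "\<And>i. i \<in> I \<Longrightarrow> linear_map S (T i) (f i)" and S: "fun_vs.subspace S" "\<And>i. i \<in> I \<Longrightarrow> x i \<in> S"
    and orth: "\<And>i k. i \<in> I \<Longrightarrow> k \<in> I \<Longrightarrow> i \<noteq> k \<Longrightarrow> f i (x k) = 0"
    and nz: "\<And>i. i \<in> I \<Longrightarrow> f i (x i) \<noteq> 0"
  shows "finite I"
proof -
  have inj: "inj_on x I" using orth nz by (metis inj_onI)
  have "fun_vs.independent (x ` I)"
    unfolding fun_vs.dependent_def
  proof (rule notI, elim bexE)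
    fix y assume "y \<in> x ` I" and y: "y \<in> fun_vs.span (x ` I - {y})"
    then obtain i where i: "i \<in> I" "y = x i" by blast
    have "y \<in> S \<and> f i y = 0" using y
    proof (induction rule: fun_vs.span_induct_alt)
      case base
      then show ?case using linear_map_zero[OF f[OF i(1)] S(1)] fun_vs.subspace_0[OF S(1)] by (simp)
    next
      case (step c u v)
      then obtain k where k: "k \<in> I" "u = x k" "k \<noteq> i" using i by blast
      then have u: "u \<in> S" "f i u = 0" using S(2) orth i by auto
      then show ?case
        using step fun_vs.subspace_add[OF S(1)] fun_vs.subspace_scale[OF S(1) u(1), of c]
          linear_map_add[OF f[OF i(1)], of "tscale c u" v] linear_map_scale[OF f[OF i(1)] u(1), of c]
        by (simp add: fun_vs.scale_zero_right)
    qed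
    then show False using nz i by simp
  qed
  then have "finite (x ` I)" using fun_vs.independent_span_bound[OF B] x by blast
  then show ?thesis using inj by (rule finite_imageD)
qed

section \<open>Paths and elementary tensors\<close>

lemma is_path_append:
  assumes "as \<noteq> []" "bs \<noteq> []"
  shows "is_path G (as @ bs) \<longleftrightarrow> is_path G as \<and> is_path G bs \<and> tgt G (last as) = src G (hd bs)"
  using assms by (auto simp: is_path_def successively_append_iff)

context groupoid
begin

lemma composite_path:
  "is_path G as \<Longrightarrow> composite G as \<in> arr G \<and> src G (composite G as) = src G (hd as) \<and>
     tgt G (composite G as) = tgt G (last as)"
proof (induction as rule: induct_list012)
  case (3 \<alpha> \<beta> as)
  then have "is_path G ([\<alpha>] @ \<beta> # as)" by simp
  then have "is_path G (\<beta> # as)" "\<alpha> \<in> arr G" "tgt G \<alpha> = src G \<beta>"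
    by (auto simp: is_path_def)
  with 3 show ?case using cmp_arr by auto
qed (auto simp: is_path_def)

lemma composite_append:
  "is_path G (as @ bs) \<Longrightarrow> as \<noteq> [] \<Longrightarrow> bs \<noteq> [] \<Longrightarrow>
     composite G (as @ bs) = cmp G (composite G bs) (composite G as)"
proof (induction as rule: induct_list012)
  case (2 \<alpha>)
  then show ?case by (cases bs) auto
next
  case (3 \<alpha> \<beta> as)
  then have p: "is_path G ([\<alpha>] @ (\<beta> # as))" "is_path G bs" "tgt G (last (\<beta> # as)) = src G (hd bs)"
    using is_path_append[of "\<alpha> # \<beta> # as" bs G] by auto
  then have q: "is_path G (\<beta> # as)" "\<alpha> \<in> arr G" "tgt G \<alpha> = src G \<beta>"
    by (auto simp: is_path_def)
  have "is_path G ((\<beta> # as) @ bs)" using p q is_path_append[of "\<beta> # as" bs G] 3 by simp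
  then have "composite G ((\<beta> # as) @ bs) = cmp G (composite G bs) (composite G (\<beta> # as))"
    using 3 by simp
  then have "composite G ((\<alpha> # \<beta> # as) @ bs) = cmp G (cmp G (composite G bs) (composite G (\<beta> # as))) \<alpha>"
    by simp
  also have "\<dots> = cmp G (composite G bs) (cmp G (composite G (\<beta> # as)) \<alpha>)"
    using cmp_assoc[of \<alpha> "composite G (\<beta> # as)" "composite G bs"] p q
      composite_path[OF p(2)] composite_path[OF q(1)] by simp
  finally show ?case by simp
qed simp

end

lemma elem_tensor_support: "elem_tensor V us xs \<noteq> 0 \<Longrightarrow> map fst xs = map fst us"
  unfolding elem_tensor_def by meson

text \<open>The tensor product of tensors of lengths \<open>k\<close> and \<open>l\<close>; only the first length has to be known to
  split the argument list.\<close>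

definition tensor_prod :: "nat \<Rightarrow> ('a, 'v) tensor \<Rightarrow> ('a, 'v) tensor \<Rightarrow> ('a, 'v) tensor" where
  "tensor_prod k u w = (\<lambda>xs. u (take k xs) * w (drop k xs))"

lemma tensor_prod_linear:
  "tensor_prod k 0 w = 0" "tensor_prod k u 0 = 0"
  "tensor_prod k (tscale c u + u') w = tscale c (tensor_prod k u w) + tensor_prod k u' w"
  "tensor_prod k u (tscale c w + w') = tscale c (tensor_prod k u w) + tensor_prod k u w'"
  by (simp_all add: tensor_prod_def tscale_def fun_eq_iff plus_fun_apply zero_fun_apply algebra_simps)

lemma elem_tensor_append_apply:
  assumes "length xs = length us"
  shows "elem_tensor V (us @ vs) (xs @ ys) = elem_tensor V us xs * elem_tensor V vs ys"
proof -
  have "(\<Prod>i<length us + length vs. snd ((xs @ ys) ! i) (snd ((us @ vs) ! i))) =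
     (\<Prod>i<length us. snd (xs ! i) (snd (us ! i))) * (\<Prod>i<length vs. snd (ys ! i) (snd (vs ! i)))"
  proof -
    let ?f = "\<lambda>i. snd ((xs @ ys) ! i) (snd ((us @ vs) ! i))"
    have "prod ?f {0..<length us + length vs} = prod ?f {0..<length us} * prod ?f {length us..<length us + length vs}"
      by (rule prod.atLeastLessThan_concat[symmetric]) auto
    also have "prod ?f {length us..<length us + length vs} = (\<Prod>i\<in>{0..<length vs}. ?f (i + length us))"
      using prod.shift_bounds_nat_ivl[of ?f 0 "length us" "length vs"] by (simp add: add.commute)
    also have "\<dots> = (\<Prod>i\<in>{0..<length vs}. snd (ys ! i) (snd (vs ! i)))"
      using assms by (intro prod.cong) (auto simp: nth_append)
    also have "prod ?f {0..<length us} = (\<Prod>i\<in>{0..<length us}. snd (xs ! i) (snd (us ! i)))"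
      using assms by (intro prod.cong) (auto simp: nth_append)
    finally show ?thesis by (simp add: lessThan_atLeast0)
  qed
  then show ?thesis using assms by (auto simp: elem_tensor_def)
qed

lemma elem_tensor_append:
  "elem_tensor V (us @ vs) = tensor_prod (length us) (elem_tensor V us) (elem_tensor V vs)"
proof
  fix xs
  let ?k = "length us"
  show "elem_tensor V (us @ vs) xs = tensor_prod ?k (elem_tensor V us) (elem_tensor V vs) xs"
  proof (cases "?k \<le> length xs")
    case True
    then show ?thesis
      using elem_tensor_append_apply[of "take ?k xs" us V vs "drop ?k xs"] by (simp add: tensor_prod_def)
  next
    case False
    then have "length xs \<noteq> length (us @ vs)" "length (take ?k xs) \<noteq> length us" by auto
    then show ?thesis using elem_tensor_support[of V us "take ?k xs"] elem_tensor_support[of V "us @ vs" xs]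
      by (metis length_map mult_zero_left tensor_prod_def)
  qed
qed

lemma elem_tensor_singleton_linear:
  assumes "vector_space (scal V)"
  shows "elem_tensor V [(\<alpha>, 0)] = 0"
    "elem_tensor V [(\<alpha>, scal V c x + y)] = tscale c (elem_tensor V [(\<alpha>, x)]) + elem_tensor V [(\<alpha>, y)]"
proof -
  have phi: "\<phi> 0 = 0" "\<phi> (scal V c x + y) = c * \<phi> x + \<phi> y"
    if "Vector_Spaces.linear (scal V) (*) \<phi>" for \<phi> c x y
  proof -
    interpret Vector_Spaces.linear "scal V" "(*)" \<phi> by fact
    show "\<phi> 0 = 0" "\<phi> (scal V c x + y) = c * \<phi> x + \<phi> y" by (simp_all add: add scale zero)
  qed
  show "elem_tensor V [(\<alpha>, 0)] = 0"
    "elem_tensor V [(\<alpha>, scal V c x + y)] = tscale c (elem_tensor V [(\<alpha>, x)]) + elem_tensor V [(\<alpha>, y)]"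
    by (auto simp: elem_tensor_def fun_eq_iff plus_fun_apply zero_fun_apply tscale_def phi map_eq_Cons_conv)
qed

text \<open>Multilinearity reduces to a single slot, since an elementary tensor is the product of its slots.\<close>

lemma elem_tensor_slot_linear:
  assumes "vector_space (scal V)"
  shows "elem_tensor V (us @ (\<alpha>, 0) # vs) = 0"
    "elem_tensor V (us @ (\<alpha>, scal V c x + y) # vs) =
       tscale c (elem_tensor V (us @ (\<alpha>, x) # vs)) + elem_tensor V (us @ (\<alpha>, y) # vs)"
proof -
  have "elem_tensor V (us @ (\<alpha>, x) # vs) =
      tensor_prod (length us) (elem_tensor V us) (tensor_prod 1 (elem_tensor V [(\<alpha>, x)]) (elem_tensor V vs))" for x
    using elem_tensor_append[of V us "(\<alpha>, x) # vs"] elem_tensor_append[of V "[(\<alpha>, x)]" vs] by simp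
  then show "elem_tensor V (us @ (\<alpha>, 0) # vs) = 0"
    "elem_tensor V (us @ (\<alpha>, scal V c x + y) # vs) =
       tscale c (elem_tensor V (us @ (\<alpha>, x) # vs)) + elem_tensor V (us @ (\<alpha>, y) # vs)"
    by (simp_all add: elem_tensor_singleton_linear[OF assms] tensor_prod_linear)
qed

context graded_space
begin

text \<open>Degrees multiply: on generators this is the composition of the two paths, and \<open>tensor_prod\<close> is
  bilinear.\<close>

lemma tensor_prod_in_tpow:
  assumes d: "tgt V \<delta> = src V \<epsilon>" "k > 0" "l > 0"
    and u: "u \<in> tpow V k {\<delta>}" and w: "w \<in> tpow V l {\<epsilon>}"
  shows "tensor_prod k u w \<in> tpow V (k + l) {cmp V \<epsilon> \<delta>}"
  using u
proof (induction rule: tpow_induct)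
  case (elem us)
  from w show ?case
  proof (induction rule: tpow_induct)
    case (elem vs)
    let ?us = "map fst us" and ?vs = "map fst vs"
    note us = \<open>length us = k\<close> \<open>is_path V ?us\<close> \<open>composite V ?us \<in> {\<delta>}\<close> \<open>\<forall>(\<alpha>, u)\<in>set us. u \<in> piece V \<alpha>\<close>
    have ne: "?us \<noteq> []" "?vs \<noteq> []" using us(2) elem(2) by (auto simp: is_path_def)
    have p: "is_path V (?us @ ?vs)"
      unfolding is_path_append[OF ne]
      using us elem d composite_path[of ?us] composite_path[of ?vs] by simp
    have "elem_tensor V (us @ vs) \<in> tpow V (k + l) {cmp V \<epsilon> \<delta>}"
      by (rule elem_tensor_in_tpow) (use us elem p composite_append[OF p ne] in auto)
    then show ?case using us by (simp add: elem_tensor_append)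
  qed (simp_all add: tensor_prod_linear tpow_zero tpow_add tpow_scale)
qed (simp_all add: tensor_prod_linear tpow_zero tpow_add tpow_scale)

section \<open>Finiteness for a fixed source\<close>

text \<open>An elementary tensor with a factor in a zero piece vanishes, so only these paths contribute to
  the tensors of source \<open>a\<close>.\<close>

definition nonzero_paths :: "nat \<Rightarrow> 'o \<Rightarrow> 'a list set" where
  "nonzero_paths m a =
    {as. length as = m \<and> is_path V as \<and> src V (hd as) = a \<and> (\<forall>\<alpha>\<in>set as. piece V \<alpha> \<noteq> {0})}"

text \<open>By finite type there are finitely many choices for the first arrow; its target is the source of
  the remaining path.\<close>

lemma finite_nonzero_paths: "a \<in> obj V \<Longrightarrow> finite (nonzero_paths m a)"
proof (induction m arbitrary: a)
  case 0
  have "nonzero_paths 0 a = {}" by (auto simp: nonzero_paths_def is_path_def)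
  then show ?case by (metis finite.emptyI)
next
  case (Suc m)
  let ?A = "{\<alpha> \<in> arr V. (src V \<alpha> = a \<or> tgt V \<alpha> = a) \<and> piece V \<alpha> \<noteq> {0}}"
  have sub: "nonzero_paths (Suc m) a \<subseteq> (\<Union>\<alpha>\<in>?A. (#) \<alpha> ` ({[]} \<union> nonzero_paths m (tgt V \<alpha>)))"
  proof
    fix xs assume xs: "xs \<in> nonzero_paths (Suc m) a"
    then obtain \<alpha> as where x: "xs = \<alpha> # as" by (auto simp: nonzero_paths_def length_Suc_conv)
    have "as = [] \<or> as \<in> nonzero_paths m (tgt V \<alpha>)"
      using xs x is_path_append[of "[\<alpha>]" as V] by (cases "as = []") (auto simp: nonzero_paths_def)
    moreover have "\<alpha> \<in> ?A" using xs x by (auto simp: nonzero_paths_def is_path_def)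
    ultimately show "xs \<in> (\<Union>\<alpha>\<in>?A. (#) \<alpha> ` ({[]} \<union> nonzero_paths m (tgt V \<alpha>)))" using x by blast
  qed
  show ?case
  proof (rule finite_subset[OF sub], intro finite_UN_I finite_imageI finite_UnI)
    show "finite ?A" using finite_type[OF Suc.prems] .
    show "finite (nonzero_paths m (tgt V \<alpha>))" if "\<alpha> \<in> ?A" for \<alpha> using that by (intro Suc.IH tgt_obj) simp
  qed simp
qed

lemma elem_tensor_nonzero_pieces:
  assumes "elem_tensor V us \<noteq> 0" "\<forall>(\<alpha>, u)\<in>set us. u \<in> piece V \<alpha>" "\<alpha> \<in> set (map fst us)"
  shows "piece V \<alpha> \<noteq> {0}"
proof
  assume z: "piece V \<alpha> = {0}"
  obtain u where "(\<alpha>, u) \<in> set us" using assms(3) by auto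
  moreover from this have "u = 0" using assms(2) z by auto
  ultimately obtain us1 us2 where "us = us1 @ (\<alpha>, 0) # us2" by (metis split_list)
  then show False using elem_tensor_slot_linear(1)[OF vs] assms(1) by simp
qed

lemma elem_tensor_nonzero_path:
  assumes "elem_tensor V us \<noteq> 0" "length us = m" "is_path V (map fst us)"
    "composite V (map fst us) \<in> src_arrows V a" "\<forall>(\<alpha>, u)\<in>set us. u \<in> piece V \<alpha>"
  shows "map fst us \<in> nonzero_paths m a"
proof -
  have "src V (hd (map fst us)) = a"
    using composite_path[OF assms(3)] assms(4) by (simp add: src_arrows_def)
  then show ?thesis
    using assms(2,3) elem_tensor_nonzero_pieces[OF assms(1,5)] unfolding nonzero_paths_def by simp
qed

text \<open>Only the composites of the finitely many paths with nonzero pieces occur as degrees. This is what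
  makes the exceptional sets of the spectral parameter, given for each degree, uniform on all
  tensors of one source.\<close>

lemma tpow_src_arrows_support:
  assumes a: "a \<in> obj V"
  obtains A where "finite A" "A \<subseteq> src_arrows V a" "tpow V m (src_arrows V a) = tpow V m A"
proof -
  let ?A = "composite V ` nonzero_paths m a"
  have sub: "?A \<subseteq> src_arrows V a" using composite_path by (auto simp: nonzero_paths_def src_arrows_def)
  have "tpow V m (src_arrows V a) \<subseteq> tpow V m ?A"
  proof
    fix u assume "u \<in> tpow V m (src_arrows V a)"
    then show "u \<in> tpow V m ?A"
    proof (induction rule: tpow_induct)
      case (elem us)
      show ?case
      proof (cases "elem_tensor V us = 0")
        case False
        then have "map fst us \<in> nonzero_paths m a" using elem by (rule elem_tensor_nonzero_path)
        then show ?thesis using elem by (intro elem_tensor_in_tpow) auto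
      qed (simp add: tpow_zero)
    qed (simp_all add: tpow_zero tpow_add tpow_scale)
  qed
  then show ?thesis
    using that[of ?A] sub tpow_mono[OF sub] finite_nonzero_paths[OF a] by blast
qed

text \<open>The elementary tensors built from spanning vectors of the pieces along the finitely many paths
  with nonzero pieces span, by multilinearity in one slot after the other.\<close>

lemma tpow_src_arrows_finite_dim:
  assumes a: "a \<in> obj V"
  obtains B where "finite B" "tpow V m (src_arrows V a) \<subseteq> fun_vs.span B"
proof -
  obtain b where b: "\<And>\<alpha>. \<alpha> \<in> arr V \<Longrightarrow> finite (b \<alpha>) \<and> piece V \<alpha> = module.span (scal V) (b \<alpha>)"
    using piece_finite_dim by metis
  interpret vs: vector_space "scal V" by (rule vs)
  define L where "L as = {us. map fst us = as \<and> (\<forall>(\<alpha>, u)\<in>set us. u \<in> b \<alpha>)}" for as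
  let ?B = "elem_tensor V ` (\<Union>as\<in>nonzero_paths m a. L as)"
  have "finite (L as)" if "as \<in> nonzero_paths m a" for as
  proof (rule finite_subset)
    let ?X = "Sigma (set as) b"
    show "L as \<subseteq> {us. set us \<subseteq> ?X \<and> length us = length as}" by (force simp: L_def)
    have "finite ?X" using that b by (intro finite_SigmaI) (auto simp: nonzero_paths_def is_path_def)
    then show "finite {us. set us \<subseteq> ?X \<and> length us = length as}" by (rule finite_lists_length_eq)
  qed
  then have fin: "finite ?B" using finite_nonzero_paths[OF a, of m] by blast
  \<comment> \<open>the slots in \<open>us\<close> already contain spanning vectors, those in \<open>ws\<close> arbitrary ones\<close>
  have step: "elem_tensor V (us @ ws) \<in> fun_vs.span ?B"
    if "map fst (us @ ws) \<in> nonzero_paths m a" "\<forall>(\<alpha>, u)\<in>set us. u \<in> b \<alpha>" "\<forall>(\<alpha>, u)\<in>set ws. u \<in> piece V \<alpha>" for us ws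
    using that
  proof (induction ws arbitrary: us)
    case Nil
    then have "us \<in> (\<Union>as\<in>nonzero_paths m a. L as)" by (auto simp: L_def)
    then show ?case by (intro fun_vs.span_base) simp
  next
    case (Cons w ws)
    obtain \<alpha> x where w: "w = (\<alpha>, x)" by (cases w)
    have "\<alpha> \<in> arr V" using Cons.prems(1) w by (auto simp: nonzero_paths_def is_path_def)
    moreover have "x \<in> piece V \<alpha>" using Cons.prems(3) w by simp
    ultimately have "x \<in> vs.span (b \<alpha>)" using b by simp
    then have "elem_tensor V (us @ (\<alpha>, x) # ws) \<in> fun_vs.span ?B"
    proof (induction rule: vs.span_induct_alt)
      case base
      then show ?case by (simp add: elem_tensor_slot_linear(1)[OF vs] fun_vs.span_zero)
    next
      case (step c x y)
      have "elem_tensor V ((us @ [(\<alpha>, x)]) @ ws) \<in> fun_vs.span ?B"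
        by (rule Cons.IH) (use Cons.prems w step in auto)
      then show ?case using step
        by (simp add: elem_tensor_slot_linear(2)[OF vs] fun_vs.span_add fun_vs.span_scale)
    qed
    then show ?case by (simp add: w)
  qed
  have "tpow V m (src_arrows V a) \<subseteq> fun_vs.span ?B"
  proof
    fix u assume "u \<in> tpow V m (src_arrows V a)"
    then show "u \<in> fun_vs.span ?B"
    proof (induction rule: tpow_induct)
      case (elem us)
      show ?case
      proof (cases "elem_tensor V us = 0")
        case False
        then have "map fst us \<in> nonzero_paths m a" using elem by (rule elem_tensor_nonzero_path)
        then show ?thesis using elem step[of "[]" us] by simp
      qed (simp add: fun_vs.span_zero)
    qed (simp_all add: fun_vs.span_zero fun_vs.span_add fun_vs.span_scale)
  qed
  then show ?thesis using that[of ?B] fin by blast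
qed

end

section \<open>Degree-preserving operators, source parts and degree parts\<close>

lemma homset_subset_arr: "homset G a b \<subseteq> arr G"
  by (auto simp: homset_def)

lemma tpow_homset_in_arr: "u \<in> tpow V m (homset V a b) \<Longrightarrow> u \<in> tpow V m (arr V)"
  and tpow_homset_in_src: "u \<in> tpow V m (homset V a b) \<Longrightarrow> u \<in> tpow V m (src_arrows V a)"
  and tpow_src_in_arr: "u \<in> tpow V m (src_arrows V a) \<Longrightarrow> u \<in> tpow V m (arr V)"
  by (erule subsetD[OF tpow_mono, rotated], auto simp: homset_def src_arrows_def)+

lemma End_tpow_linear: "Q \<in> End_tpow V m \<Longrightarrow> linear_map (tpow V m (arr V)) (tpow V m (arr V)) Q"
  by (simp add: End_tpow_def)

lemma End_tpow_preserves:
  assumes Q: "Q \<in> End_tpow V m" and A: "A \<subseteq> arr V" and u: "u \<in> tpow V m A"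
  shows "Q u \<in> tpow V m A"
  using u
proof (induction rule: tpow_induct_degree)
  case zero
  then show ?case using linear_map_zero[OF End_tpow_linear[OF Q] subspace_tpow] by (simp add: tpow_zero)
next
  case (homogeneous \<gamma> u)
  then have "Q u \<in> tpow V m {\<gamma>}" using Q A by (auto simp: End_tpow_def)
  then show ?case using tpow_mono[of "{\<gamma>}" A V m] homogeneous by auto
next
  case (add u v)
  have "u \<in> tpow V m (arr V)" "v \<in> tpow V m (arr V)" using add(1,2) tpow_mono[OF A] by blast+
  then have "Q (u + v) = Q u + Q v" by (rule linear_map_add[OF End_tpow_linear[OF Q]])
  then show "Q (u + v) \<in> tpow V m A" using add(3,4) by (simp add: tpow_add)
qed

lemma id_End_tpow: "id \<in> End_tpow V m"
  by (simp add: End_tpow_def linear_map_def)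

lemma End_tpow_comp: "Q \<in> End_tpow V m \<Longrightarrow> Q' \<in> End_tpow V m \<Longrightarrow> Q \<circ> Q' \<in> End_tpow V m"
  by (auto simp: End_tpow_def linear_map_def)

lemma End_tpow_eq_on:
  assumes Q: "Q \<in> End_tpow V m" "Q' \<in> End_tpow V m" and A: "A \<subseteq> arr V"
    and eq: "\<And>\<alpha> u. \<alpha> \<in> A \<Longrightarrow> u \<in> tpow V m {\<alpha>} \<Longrightarrow> Q u = Q' u"
    and u: "u \<in> tpow V m A"
  shows "Q u = Q' u"
  using u
proof (induction rule: tpow_induct_degree)
  case zero
  then show ?case using linear_map_zero[OF End_tpow_linear[OF Q(1)] subspace_tpow]
    linear_map_zero[OF End_tpow_linear[OF Q(2)] subspace_tpow] by simp
next
  case (add u v)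
  have uv: "u \<in> tpow V m (arr V)" "v \<in> tpow V m (arr V)" using add(1,2) tpow_mono[OF A] by blast+
  show "Q (u + v) = Q' (u + v)"
    using add(3,4) linear_map_add[OF End_tpow_linear[OF Q(1)] uv] linear_map_add[OF End_tpow_linear[OF Q(2)] uv]
    by simp
qed (rule eq)

context graded_space
begin

text \<open>A tensor of source \<open>a\<close> is a function supported on lists whose first arrow has source \<open>a\<close>; hence
  \<open>source_part\<close>, which restricts functions, is the projection onto a summand.\<close>

lemma tpow_src_arrows_supportD:
  assumes "u \<in> tpow V m (src_arrows V a)" "u xs \<noteq> 0"
  shows "xs \<noteq> [] \<and> fst (hd xs) \<in> arr V \<and> src V (fst (hd xs)) = a"
proof -
  have "u xs \<noteq> 0 \<longrightarrow> xs \<noteq> [] \<and> fst (hd xs) \<in> arr V \<and> src V (fst (hd xs)) = a"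
    using assms(1)
  proof (induction rule: tpow_induct)
    case (elem us)
    show ?case
    proof
      assume "elem_tensor V us xs \<noteq> 0"
      then have x: "map fst xs = map fst us" by (rule elem_tensor_support)
      then have "xs \<noteq> []" using elem(2) by (auto simp: is_path_def)
      then have "fst (hd xs) = hd (map fst us)" "hd (map fst us) \<in> set (map fst us)"
        using x by (metis hd_map) (use x \<open>xs \<noteq> []\<close> in \<open>metis list.map_disc_iff hd_in_set\<close>)
      then show "xs \<noteq> [] \<and> fst (hd xs) \<in> arr V \<and> src V (fst (hd xs)) = a"
        using \<open>xs \<noteq> []\<close> elem(2,3) composite_path[OF elem(2)] by (auto simp: is_path_def src_arrows_def)
    qed
  qed (auto simp: zero_fun_apply plus_fun_apply tscale_def)
  then show ?thesis using assms(2) by simp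
qed

lemma source_part_tpow:
  assumes "u \<in> tpow V m (src_arrows V a)"
  shows "source_part V b u = (if a = b then u else 0)"
  using tpow_src_arrows_supportD[OF assms] by (fastforce simp: source_part_def fun_eq_iff zero_fun_apply)

lemma source_part_add: "source_part V b (u + v) = source_part V b u + source_part V b v"
  by (simp add: source_part_def fun_eq_iff plus_fun_apply)

lemma source_part_in_tpow:
  assumes "u \<in> tpow V m (arr V)"
  shows "source_part V b u \<in> tpow V m (src_arrows V b)"
  using assms
proof (induction rule: tpow_induct_degree)
  case zero
  have "source_part V b (0 :: ('a, 'v) tensor) = 0" by (simp add: source_part_def fun_eq_iff zero_fun_apply)
  then show "source_part V b 0 \<in> tpow V m (src_arrows V b)" by (simp add: tpow_zero)
next
  case (homogeneous \<gamma> u)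
  then have "u \<in> tpow V m (src_arrows V (src V \<gamma>))"
    using tpow_mono[of "{\<gamma>}" "src_arrows V (src V \<gamma>)" V m] by (auto simp: src_arrows_def)
  then show ?case using source_part_tpow[of u m "src V \<gamma>" b] by (auto simp: tpow_zero)
qed (simp add: source_part_add tpow_add)

end

text \<open>An elementary tensor lies in the piece of its own degree, so linearity spreads a degree check on
  elementary tensors to every piece.\<close>

lemma End_tpowI:
  fixes V :: "('o, 'a, 'v::ab_group_add) graded"
  assumes add: "\<And>u v. u \<in> tpow V m (arr V) \<Longrightarrow> v \<in> tpow V m (arr V) \<Longrightarrow> f (u + v) = f u + f v"
    and scale: "\<And>c u. u \<in> tpow V m (arr V) \<Longrightarrow> f (tscale c u) = tscale c (f u)"
    and elem: "\<And>us. length us = m \<Longrightarrow> is_path V (map fst us) \<Longrightarrow> composite V (map fst us) \<in> arr V \<Longrightarrow>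
      \<forall>(\<alpha>, u)\<in>set us. u \<in> piece V \<alpha> \<Longrightarrow>
      f (elem_tensor V us) \<in> tpow V m {composite V (map fst us)}"
  shows "f \<in> End_tpow V m"
proof -
  have "f (tscale 0 0) = tscale 0 (f 0)" by (rule scale[OF tpow_zero])
  then have zero: "f 0 = 0" by (simp add: fun_vs.scale_zero_left)
  have sub: "f u \<in> tpow V m A" if A: "A \<subseteq> arr V" and u: "u \<in> tpow V m A" for A u
    using u
  proof (induction rule: tpow_induct)
    case zero
    show "f 0 \<in> tpow V m A" by (simp add: \<open>f 0 = 0\<close> tpow_zero)
  next
    case (elem us)
    show ?case
      by (rule subsetD[OF tpow_mono assms(3)]) (use elem A in auto)
  next
    case (add c u v)
    have uv: "u \<in> tpow V m (arr V)" "v \<in> tpow V m (arr V)" using add(1,2) tpow_mono[OF A] by blast+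
    have "f (tscale c u + v) = tscale c (f u) + f v"
      using assms(1)[OF tpow_scale[OF uv(1)] uv(2)] scale[OF uv(1)] by simp
    then show "f (tscale c u + v) \<in> tpow V m A" using add(3,4) by (simp add: tpow_add tpow_scale)
  qed
  show ?thesis unfolding End_tpow_def linear_map_def using add scale sub by auto
qed

lemma tpow_length:
  assumes "u \<in> tpow V m A" "u xs \<noteq> 0"
  shows "length xs = m"
proof -
  have "u xs \<noteq> 0 \<longrightarrow> length xs = m"
    using assms(1)
  proof (induction rule: tpow_induct)
    case (elem us)
    then show ?case using elem_tensor_support[of V us xs] by (metis length_map)
  qed (auto simp: zero_fun_apply plus_fun_apply tscale_def)
  then show ?thesis using assms(2) by simp
qed

context graded_space
begin

text \<open>A generator of length \<open>k + l\<close> is a product of homogeneous tensors of composable degrees \<open>\<delta>\<close>, \<open>\<epsilon>\<close>.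
  Both lengths are positive because the empty path has no composite.\<close>

lemma path_split:
  assumes us: "length us = k + l" "is_path V (map fst us)" "\<forall>(\<alpha>, u)\<in>set us. u \<in> piece V \<alpha>"
    and kl: "k > 0" "l > 0"
  obtains us1 us2 \<delta> \<epsilon> where "us = us1 @ us2" "length us1 = k" "length us2 = l"
    "\<delta> \<in> arr V" "\<epsilon> \<in> arr V" "tgt V \<delta> = src V \<epsilon>" "composite V (map fst us) = cmp V \<epsilon> \<delta>"
    "elem_tensor V us1 \<in> tpow V k {\<delta>}" "elem_tensor V us2 \<in> tpow V l {\<epsilon>}"
proof -
  let ?us1 = "take k us" and ?us2 = "drop k us"
  let ?a = "map fst ?us1" and ?b = "map fst ?us2"
  have len: "length ?us1 = k" "length ?us2 = l" using us by auto
  then have ne: "?a \<noteq> []" "?b \<noteq> []" using kl by auto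
  have split: "map fst us = ?a @ ?b" by (metis append_take_drop_id map_append)
  have p: "is_path V ?a" "is_path V ?b" "tgt V (last ?a) = src V (hd ?b)"
    using us(2) is_path_append[OF ne, of V] unfolding split by blast+
  have "composite V (map fst us) = cmp V (composite V ?b) (composite V ?a)"
    unfolding split using us(2) split ne by (intro composite_append) simp_all
  moreover have "elem_tensor V ?us1 \<in> tpow V k {composite V ?a}"
    by (rule elem_tensor_in_tpow) (use len p us(3) in_set_takeD in fastforce)+
  moreover have "elem_tensor V ?us2 \<in> tpow V l {composite V ?b}"
    by (rule elem_tensor_in_tpow) (use len p us(3) in_set_dropD in fastforce)+
  ultimately show ?thesis
    using that[of ?us1 ?us2 "composite V ?a" "composite V ?b"] len composite_path[OF p(1)] composite_path[OF p(2)] p(3)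
    by simp
qed

text \<open>The operators \<open>leg12\<close> and \<open>leg23\<close> apply \<open>Q\<close> to slices of a tensor. The linearity of \<open>Q\<close> is known
  on the tensor square only, so slices have to be located there; on an elementary tensor a slice is a
  multiple of one of its two factors.\<close>

lemma slice_tpow:
  assumes t: "t \<in> tpow V (k + l) (arr V)" and kl: "k > 0" "l > 0"
  shows "length zs = l \<Longrightarrow> (\<lambda>ys. t (ys @ zs)) \<in> tpow V k (arr V)"
    and "length ys = k \<Longrightarrow> (\<lambda>zs. t (ys @ zs)) \<in> tpow V l (arr V)"
proof -
  have "(length zs = l \<longrightarrow> (\<lambda>ys. t (ys @ zs)) \<in> tpow V k (arr V)) \<and>
    (length ys = k \<longrightarrow> (\<lambda>zs. t (ys @ zs)) \<in> tpow V l (arr V))"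
    using t
  proof (induction rule: tpow_induct)
    case zero
    have "(\<lambda>ys. (0 :: ('a, 'v) tensor) (ys @ zs)) = 0" "(\<lambda>zs. (0 :: ('a, 'v) tensor) (ys @ zs)) = 0"
      by (simp_all add: fun_eq_iff zero_fun_apply)
    then show ?case by (simp add: tpow_zero)
  next
    case (elem us)
    obtain us1 us2 \<delta> \<epsilon> where us: "us = us1 @ us2" "length us1 = k" "length us2 = l"
      "\<delta> \<in> arr V" "\<epsilon> \<in> arr V"
      "elem_tensor V us1 \<in> tpow V k {\<delta>}" "elem_tensor V us2 \<in> tpow V l {\<epsilon>}"
      using path_split[OF elem(1,2,4) kl] by metis
    have in_arr: "elem_tensor V us1 \<in> tpow V k (arr V)" "elem_tensor V us2 \<in> tpow V l (arr V)"
      using us(4-7) tpow_mono[of "{\<delta>}" "arr V" V k] tpow_mono[of "{\<epsilon>}" "arr V" V l] by auto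
    have eq: "elem_tensor V us (ys @ zs) = elem_tensor V us1 ys * elem_tensor V us2 zs"
      if "length zs = l \<or> length ys = k" for ys zs
    proof (cases "length ys = k")
      case True
      then show ?thesis unfolding us(1) by (intro elem_tensor_append_apply) (simp add: us(2))
    next
      case False
      then have "length (ys @ zs) \<noteq> length us" using that us by auto
      then have "elem_tensor V us (ys @ zs) = 0" "elem_tensor V us1 ys = 0"
        using False us elem_tensor_support[of V us "ys @ zs"] elem_tensor_support[of V us1 ys]
        by (metis length_map)+
      then show ?thesis by simp
    qed
    have "(\<lambda>ys. elem_tensor V us (ys @ zs)) = tscale (elem_tensor V us2 zs) (elem_tensor V us1)" if "length zs = l"
      using eq that by (auto simp: tscale_def)
    moreover have "(\<lambda>zs. elem_tensor V us (ys @ zs)) = tscale (elem_tensor V us1 ys) (elem_tensor V us2)" if "length ys = k"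
      using eq that by (auto simp: tscale_def)
    ultimately show ?case using in_arr by (simp add: tpow_scale)
  next
    case (add c u v)
    have "(\<lambda>ys. (tscale c u + v) (ys @ zs)) = tscale c (\<lambda>ys. u (ys @ zs)) + (\<lambda>ys. v (ys @ zs))"
      "(\<lambda>zs. (tscale c u + v) (ys @ zs)) = tscale c (\<lambda>zs. u (ys @ zs)) + (\<lambda>zs. v (ys @ zs))"
      by (simp_all add: fun_eq_iff plus_fun_apply tscale_def)
    then show ?case using add(3,4) by (simp add: tpow_add tpow_scale)
  qed
  then show "length zs = l \<Longrightarrow> (\<lambda>ys. t (ys @ zs)) \<in> tpow V k (arr V)"
    and "length ys = k \<Longrightarrow> (\<lambda>zs. t (ys @ zs)) \<in> tpow V l (arr V)" by blast+
qed

text \<open>On a generator \<open>u \<otimes> w\<close> the operator gives \<open>Q u \<otimes> w\<close>, and \<open>Q u\<close> has the degree of \<open>u\<close>.\<close>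

lemma leg12_End:
  assumes Q: "Q \<in> End_tpow V 2"
  shows "leg12 Q \<in> End_tpow V 3"
proof (rule End_tpowI)
  note lin = End_tpow_linear[OF Q]
  have slice: "(\<lambda>ys. u (ys @ drop 2 xs)) \<in> tpow V 2 (arr V)"
    if "length xs = 3" "u \<in> tpow V 3 (arr V)" for u and xs :: "('a \<times> ('v \<Rightarrow> complex)) list"
    using slice_tpow(1)[of u 2 1 "drop 2 xs"] that by simp
  show "leg12 Q (u + v) = leg12 Q u + leg12 Q v"
    if uv: "u \<in> tpow V 3 (arr V)" "v \<in> tpow V 3 (arr V)" for u v
  proof
    fix xs
    show "leg12 Q (u + v) xs = (leg12 Q u + leg12 Q v) xs"
    proof (cases "length xs = 3")
      case True
      have "leg12 Q (u + v) xs = Q (\<lambda>ys. (u + v) (ys @ drop 2 xs)) (take 2 xs)"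
        using True by (simp add: leg12_def)
      also have "(\<lambda>ys. (u + v) (ys @ drop 2 xs)) = (\<lambda>ys. u (ys @ drop 2 xs)) + (\<lambda>ys. v (ys @ drop 2 xs))"
        by (simp add: fun_eq_iff plus_fun_apply)
      also have "Q \<dots> = Q (\<lambda>ys. u (ys @ drop 2 xs)) + Q (\<lambda>ys. v (ys @ drop 2 xs))"
        by (rule linear_map_add[OF lin slice[OF True uv(1)] slice[OF True uv(2)]])
      finally show ?thesis using True by (simp add: leg12_def plus_fun_apply)
    qed (simp add: leg12_def plus_fun_apply)
  qed
  show "leg12 Q (tscale c u) = tscale c (leg12 Q u)" if "u \<in> tpow V 3 (arr V)" for c u
  proof
    fix xs
    show "leg12 Q (tscale c u) xs = tscale c (leg12 Q u) xs"
      using linear_map_scale[OF lin slice[OF _ that], of xs c] by (simp add: leg12_def tscale_def)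
  qed
  fix us assume us: "length us = 3" "is_path V (map fst us)" "\<forall>(\<alpha>, u)\<in>set us. u \<in> piece V \<alpha>"
  obtain us1 us2 \<delta> \<epsilon> where s: "us = us1 @ us2" "length us1 = 2" "length us2 = 1"
    "\<delta> \<in> arr V" "\<epsilon> \<in> arr V" "tgt V \<delta> = src V \<epsilon>" "composite V (map fst us) = cmp V \<epsilon> \<delta>"
    "elem_tensor V us1 \<in> tpow V 2 {\<delta>}" "elem_tensor V us2 \<in> tpow V 1 {\<epsilon>}"
    by (rule path_split[OF _ us(2,3), of 2 1]) (use us(1) in auto)
  let ?u = "elem_tensor V us1" and ?w = "elem_tensor V us2"
  have Qu: "Q ?u \<in> tpow V 2 {\<delta>}" using s(4) by (intro End_tpow_preserves[OF Q _ s(8)]) simp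
  have u: "?u \<in> tpow V 2 (arr V)" using s(4,8) tpow_mono[of "{\<delta>}" "arr V" V 2] by auto
  have "leg12 Q (elem_tensor V us) = tensor_prod 2 (Q ?u) ?w"
  proof
    fix xs
    show "leg12 Q (elem_tensor V us) xs = tensor_prod 2 (Q ?u) ?w xs"
    proof (cases "length xs = 3")
      case True
      have "leg12 Q (\<lambda>xs. ?u (take 2 xs) * ?w (drop 2 xs)) xs = Q ?u (take 2 xs) * ?w (drop 2 xs)"
        by (rule leg12_tensor[OF lin u _ _ True]) (use tpow_length[OF s(8)] tpow_length[OF s(9)] in blast)+
      then show ?thesis using elem_tensor_append[of V us1 us2] s(1,2) by (simp add: tensor_prod_def)
    next
      case False
      have "Q ?u (take 2 xs) = 0 \<or> ?w (drop 2 xs) = 0"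
        using tpow_length[OF Qu, of "take 2 xs"] tpow_length[OF s(9), of "drop 2 xs"] False by fastforce
      then show ?thesis using False by (auto simp: leg12_def tensor_prod_def)
    qed
  qed
  then show "leg12 Q (elem_tensor V us) \<in> tpow V 3 {composite V (map fst us)}"
    using tensor_prod_in_tpow[OF s(6) _ _ Qu s(9)] s(7) by simp
qed

lemma leg23_End:
  assumes Q: "Q \<in> End_tpow V 2"
  shows "leg23 Q \<in> End_tpow V 3"
proof (rule End_tpowI)
  note lin = End_tpow_linear[OF Q]
  have slice: "(\<lambda>ys. u (take 1 xs @ ys)) \<in> tpow V 2 (arr V)"
    if "length xs = 3" "u \<in> tpow V 3 (arr V)" for u and xs :: "('a \<times> ('v \<Rightarrow> complex)) list"
  proof -
    have "(1::nat) + 2 = 3" by simp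
    with that show ?thesis using slice_tpow(2)[of u 1 2 "take 1 xs"] by (metis length_take min.absorb2 one_le_numeral
        zero_less_numeral zero_less_one)
  qed
  show "leg23 Q (u + v) = leg23 Q u + leg23 Q v"
    if uv: "u \<in> tpow V 3 (arr V)" "v \<in> tpow V 3 (arr V)" for u v
  proof
    fix xs
    show "leg23 Q (u + v) xs = (leg23 Q u + leg23 Q v) xs"
    proof (cases "length xs = 3")
      case True
      have "leg23 Q (u + v) xs = Q (\<lambda>ys. (u + v) (take 1 xs @ ys)) (drop 1 xs)"
        using True by (simp add: leg23_def)
      also have "(\<lambda>ys. (u + v) (take 1 xs @ ys)) = (\<lambda>ys. u (take 1 xs @ ys)) + (\<lambda>ys. v (take 1 xs @ ys))"
        by (simp add: fun_eq_iff plus_fun_apply)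
      also have "Q \<dots> = Q (\<lambda>ys. u (take 1 xs @ ys)) + Q (\<lambda>ys. v (take 1 xs @ ys))"
        by (rule linear_map_add[OF lin slice[OF True uv(1)] slice[OF True uv(2)]])
      finally show ?thesis using True by (simp add: leg23_def plus_fun_apply)
    qed (simp add: leg23_def plus_fun_apply)
  qed
  show "leg23 Q (tscale c u) = tscale c (leg23 Q u)" if "u \<in> tpow V 3 (arr V)" for c u
  proof
    fix xs
    show "leg23 Q (tscale c u) xs = tscale c (leg23 Q u) xs"
      using linear_map_scale[OF lin slice[OF _ that], of xs c] by (simp add: leg23_def tscale_def)
  qed
  fix us assume us: "length us = 3" "is_path V (map fst us)" "\<forall>(\<alpha>, u)\<in>set us. u \<in> piece V \<alpha>"
  obtain us1 us2 \<delta> \<epsilon> where s: "us = us1 @ us2" "length us1 = 1" "length us2 = 2"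
    "\<delta> \<in> arr V" "\<epsilon> \<in> arr V" "tgt V \<delta> = src V \<epsilon>" "composite V (map fst us) = cmp V \<epsilon> \<delta>"
    "elem_tensor V us1 \<in> tpow V 1 {\<delta>}" "elem_tensor V us2 \<in> tpow V 2 {\<epsilon>}"
    by (rule path_split[OF _ us(2,3), of 1 2]) (use us(1) in auto)
  let ?w = "elem_tensor V us1" and ?u = "elem_tensor V us2"
  have Qu: "Q ?u \<in> tpow V 2 {\<epsilon>}" using s(5) by (intro End_tpow_preserves[OF Q _ s(9)]) simp
  have u: "?u \<in> tpow V 2 (arr V)" using s(5,9) tpow_mono[of "{\<epsilon>}" "arr V" V 2] by auto
  have "leg23 Q (elem_tensor V us) = tensor_prod 1 ?w (Q ?u)"
  proof
    fix xs
    show "leg23 Q (elem_tensor V us) xs = tensor_prod 1 ?w (Q ?u) xs"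
    proof (cases "length xs = 3")
      case True
      have "leg23 Q (\<lambda>xs. ?w (take 1 xs) * ?u (drop 1 xs)) xs = ?w (take 1 xs) * Q ?u (drop 1 xs)"
        by (rule leg23_tensor[OF lin u _ True]) (use tpow_length[OF s(9)] in blast)
      then show ?thesis using elem_tensor_append[of V us1 us2] s(1,2) by (simp add: tensor_prod_def)
    next
      case False
      have "Q ?u (drop 1 xs) = 0"
        using tpow_length[OF Qu, of "drop 1 xs"] False by fastforce
      then show ?thesis using False by (auto simp: leg23_def tensor_prod_def)
    qed
  qed
  then show "leg23 Q (elem_tensor V us) \<in> tpow V 3 {composite V (map fst us)}"
    using tensor_prod_in_tpow[OF s(6) _ _ s(8) Qu] s(7) by (simp add: numeral_3_eq_3)
qed

text \<open>A tensor is a function of a list of arrows, so its component of degree \<open>\<gamma>\<close> is the restriction to the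
  lists with composite \<open>\<gamma>\<close>. It extends linear forms on one piece to the whole space.\<close>

definition degree_part :: "'a \<Rightarrow> ('a, 'v) tensor \<Rightarrow> ('a, 'v) tensor" where
  "degree_part \<gamma> u = (\<lambda>xs. if composite V (map fst xs) = \<gamma> then u xs else 0)"

lemma degree_part_linear:
  "degree_part \<gamma> 0 = 0" "degree_part \<gamma> (u + v) = degree_part \<gamma> u + degree_part \<gamma> v"
  "degree_part \<gamma> (tscale c u) = tscale c (degree_part \<gamma> u)"
  by (simp_all add: degree_part_def fun_eq_iff plus_fun_apply zero_fun_apply tscale_def)

lemma degree_part_elem:
  "degree_part \<gamma> (elem_tensor V us) = (if composite V (map fst us) = \<gamma> then elem_tensor V us else 0)"
  using elem_tensor_support[of V us] by (fastforce simp: degree_part_def fun_eq_iff zero_fun_apply)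

lemma degree_part_in_tpow:
  assumes "u \<in> tpow V m A"
  shows "degree_part \<gamma> u \<in> tpow V m {\<gamma>}"
  using assms
proof (induction rule: tpow_induct)
  case (elem us)
  then show ?case using elem_tensor_in_tpow[of us m V "{\<gamma>}"] by (auto simp: degree_part_elem tpow_zero)
qed (simp_all add: degree_part_linear tpow_zero tpow_add tpow_scale)

lemma degree_part_id:
  assumes "u \<in> tpow V m {\<gamma>}"
  shows "degree_part \<gamma> u = u"
  using assms
  by (induction rule: tpow_induct) (auto simp: degree_part_linear degree_part_elem)

end

section \<open>Transfer operators over a unique connecting system\<close>

locale unique_transfer = V1: graded_space V1 + V2: graded_space V2
  for V1 :: "('o1, 'a1, 'v1::ab_group_add) graded" and V2 :: "('o2, 'a2, 'v2::ab_group_add) graded" +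
  fixes P S :: "'p set" and s :: "'p \<Rightarrow> 'o1" and t :: "'p \<Rightarrow> 'o2" and m :: nat
    and g :: "'p \<Rightarrow> 'p \<Rightarrow> ('a2, 'v2) tensor \<Rightarrow> ('a1, 'v1) tensor"
    and g' :: "'p \<Rightarrow> 'p \<Rightarrow> ('a1, 'v1) tensor \<Rightarrow> ('a2, 'v2) tensor"
  assumes s_onto: "s ` P = obj V1" and t_onto: "t ` P = obj V2"
    and unique: "unique_connecting_system P s t V2 S"
    and right_inv: "right_inverse P s t m V1 V2 g g'"
begin

abbreviation "W1 \<equiv> tpow V1 m (arr V1)"
abbreviation "W2 \<equiv> tpow V2 m (arr V2)"

lemma g_linear: "\<beta> \<in> P \<Longrightarrow> \<beta>' \<in> P \<Longrightarrow> linear_map W2 (tpow V1 m (homset V1 (s \<beta>) (s \<beta>'))) (g \<beta> \<beta>')"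
  using right_inv by (simp add: right_inverse_def Gamma_WV_def transfer_Hom_def)

lemma g'_linear: "\<beta> \<in> P \<Longrightarrow> \<beta>' \<in> P \<Longrightarrow> linear_map W1 (tpow V2 m (homset V2 (t \<beta>') (t \<beta>))) (g' \<beta> \<beta>')"
  using right_inv by (simp add: right_inverse_def Gamma_VW_def transfer_Hom_def)

lemma g_in_W1: "\<beta> \<in> P \<Longrightarrow> \<beta>' \<in> P \<Longrightarrow> u \<in> W2 \<Longrightarrow> g \<beta> \<beta>' u \<in> W1"
  by (rule tpow_homset_in_arr[OF linear_map_in[OF g_linear]])

lemma g'_in_W2: "\<beta> \<in> P \<Longrightarrow> \<beta>' \<in> P \<Longrightarrow> v \<in> W1 \<Longrightarrow> g' \<beta> \<beta>' v \<in> W2"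
  by (rule tpow_homset_in_arr[OF linear_map_in[OF g'_linear]])

lemma g_zero: "\<beta> \<in> P \<Longrightarrow> \<beta>' \<in> P \<Longrightarrow> g \<beta> \<beta>' 0 = 0"
  and g'_zero: "\<beta> \<in> P \<Longrightarrow> \<beta>' \<in> P \<Longrightarrow> g' \<beta> \<beta>' 0 = 0"
  using linear_map_zero[OF g_linear subspace_tpow] linear_map_zero[OF g'_linear subspace_tpow] by auto

lemma g_vanishes:
  assumes P: "\<beta> \<in> P" "\<beta>' \<in> P" and A: "A \<subseteq> arr V2" "A \<inter> homset V2 (t \<beta>) (t \<beta>') = {}"
    and u: "u \<in> tpow V2 m A"
  shows "g \<beta> \<beta>' u = 0"
  using u
proof (induction rule: tpow_induct_degree)
  case zero
  show "g \<beta> \<beta>' 0 = 0" using P by (rule g_zero)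
next
  case (homogeneous \<gamma> u)
  have "g \<beta> \<beta>' \<in> transfer_Hom m V2 (t \<beta>) (t \<beta>') V1 (s \<beta>) (s \<beta>')"
    using right_inv P by (simp add: right_inverse_def Gamma_WV_def)
  moreover have "\<gamma> \<in> arr V2 - homset V2 (t \<beta>) (t \<beta>')" using A homogeneous by auto
  ultimately show ?case using homogeneous by (simp add: transfer_Hom_def)
next
  case (add u v)
  have uv: "u \<in> W2" "v \<in> W2" using add(1,2) tpow_mono[OF A(1)] by blast+
  show "g \<beta> \<beta>' (u + v) = 0" using add(3,4) linear_map_add[OF g_linear[OF P] uv] by simp
qed

lemma g'_vanishes:
  assumes P: "\<beta> \<in> P" "\<beta>' \<in> P" and "\<alpha> \<in> arr V1" "\<alpha> \<notin> homset V1 (s \<beta>') (s \<beta>)" "v \<in> tpow V1 m {\<alpha>}"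
  shows "g' \<beta> \<beta>' v = 0"
proof -
  have "g' \<beta> \<beta>' \<in> transfer_Hom m V1 (s \<beta>') (s \<beta>) V2 (t \<beta>') (t \<beta>)"
    using right_inv P by (simp add: right_inverse_def Gamma_VW_def)
  then show ?thesis using assms by (simp add: transfer_Hom_def)
qed

lemma connecting: "connecting_system P t V2 S"
  using unique by (simp add: unique_connecting_system_def)

lemma connect_ex1: "\<gamma> \<in> arr V2 \<Longrightarrow> \<exists>!\<beta>. \<beta> \<in> S \<and> t \<beta> = src V2 \<gamma>"
  using connecting by (simp add: connecting_system_def)

lemma connect_in: "\<gamma> \<in> arr V2 \<Longrightarrow> connect V2 t S \<gamma> \<in> S \<and> t (connect V2 t S \<gamma>) = src V2 \<gamma>"
  unfolding connect_def by (rule theI'[OF connect_ex1])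

lemma S_subset: "\<beta> \<in> S \<Longrightarrow> \<beta> \<in> P"
  using connecting by (auto simp: connecting_system_def)

lemma connect_eq: "\<beta> \<in> S \<Longrightarrow> \<gamma> \<in> arr V2 \<Longrightarrow> src V2 \<gamma> = t \<beta> \<Longrightarrow> connect V2 t S \<gamma> = \<beta>"
  unfolding connect_def by (rule the1_equality[OF connect_ex1]) auto

lemma S_unique:
  assumes "\<beta> \<in> S" "\<beta>' \<in> P" "s \<beta>' = s \<beta>"
  shows "\<beta>' = \<beta>"
proof -
  obtain \<gamma> where "\<gamma> \<in> arr V2" "\<beta> = connect V2 t S \<gamma>"
    using unique assms(1) unfolding unique_connecting_system_def connecting_system_def by blast
  moreover from this have "{\<beta> \<in> P. s \<beta> = s (connect V2 t S \<gamma>)} = {connect V2 t S \<gamma>}"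
    using unique unfolding unique_connecting_system_def by blast
  ultimately show ?thesis using assms by blast
qed

text \<open>The heart of the argument. Right invertibility says that a sum over all elements \<open>b\<close> of \<open>P\<close>
  is a Kronecker delta. Evaluated at \<open>v\<close> of source \<open>s \<beta>\<^sub>0\<close>, only \<open>b\<close> over that source contribute, and
  \<open>\<beta>\<^sub>0\<close> is the only one. So the sum collapses to a single product, and the maps
  \<open>g \<beta>\<^sub>0 \<beta>\<close> and \<open>g' \<beta>' \<beta>\<^sub>0\<close> form a dual system.\<close>

lemma g_g':
  assumes \<beta>0: "\<beta>\<^sub>0 \<in> S" and P: "\<beta> \<in> P" "\<beta>' \<in> P" and t: "t \<beta> = t \<beta>'"
    and ne: "homset V2 (t \<beta>\<^sub>0) (t \<beta>) \<noteq> {}" and v: "v \<in> tpow V1 m (homset V1 (s \<beta>\<^sub>0) (s \<beta>'))"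
  shows "g \<beta>\<^sub>0 \<beta> (g' \<beta>' \<beta>\<^sub>0 v) = (if \<beta> = \<beta>' then v else 0)"
  using v
proof (induction rule: tpow_induct_degree)
  case zero
  show "g \<beta>\<^sub>0 \<beta> (g' \<beta>' \<beta>\<^sub>0 0) = (if \<beta> = \<beta>' then 0 else 0)"
    using g_zero[OF S_subset[OF \<beta>0] P(1)] g'_zero[OF P(2) S_subset[OF \<beta>0]] by simp
next
  case (homogeneous \<alpha> v)
  note b0 = S_subset[OF \<beta>0]
  \<comment> \<open>the arrow of \<open>V2\<close> that \<open>transferred\<close> asks for is provided by the nonempty hom-set\<close>
  have "\<alpha> \<in> transferred P s t V1 V2 \<beta>'"
    using homogeneous b0 ne t by (auto simp: transferred_def)
  then have "star P g g' \<beta>' \<beta> v = (if \<beta>' = \<beta> then v else 0)"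
    using right_inv P t homogeneous(2) unfolding right_inverse_def by simp
  moreover have "star P g g' \<beta>' \<beta> v = g \<beta>\<^sub>0 \<beta> (g' \<beta>' \<beta>\<^sub>0 v)"
  proof -
    \<comment> \<open>only the source of \<open>\<alpha>\<close> contributes, and \<open>\<beta>\<^sub>0\<close> is the only element of \<open>P\<close> over it\<close>
    have "g b \<beta> (g' \<beta>' b v) = 0" if "b \<in> P" "b \<noteq> \<beta>\<^sub>0" for b
    proof -
      have "s b \<noteq> s \<beta>\<^sub>0" using S_unique[OF \<beta>0] that by blast
      then have "g' \<beta>' b v = 0"
        using homogeneous P that by (intro g'_vanishes[of _ _ \<alpha>]) (auto simp: homset_def)
      then show ?thesis using g_zero that P by simp
    qed
    then have "{b \<in> P. g b \<beta> (g' \<beta>' b v) \<noteq> 0} \<subseteq> {\<beta>\<^sub>0}" by blast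
    then have "star P g g' \<beta>' \<beta> v = (\<Sum>b\<in>{\<beta>\<^sub>0}. g b \<beta> (g' \<beta>' b v))"
      unfolding star_def using b0 by (intro sum.mono_neutral_left) auto
    then show ?thesis by simp
  qed
  ultimately show ?case by auto
next
  case (add u v)
  note b0 = S_subset[OF \<beta>0]
  have uv: "u \<in> W1" "v \<in> W1" by (rule tpow_homset_in_arr, fact add)+
  have "g \<beta>\<^sub>0 \<beta> (g' \<beta>' \<beta>\<^sub>0 (u + v)) = g \<beta>\<^sub>0 \<beta> (g' \<beta>' \<beta>\<^sub>0 u) + g \<beta>\<^sub>0 \<beta> (g' \<beta>' \<beta>\<^sub>0 v)"
    unfolding linear_map_add[OF g'_linear[OF P(2) b0] uv]
    by (rule linear_map_add[OF g_linear[OF b0 P(1)] g'_in_W2[OF P(2) b0 uv(1)] g'_in_W2[OF P(2) b0 uv(2)]])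
  then show "g \<beta>\<^sub>0 \<beta> (g' \<beta>' \<beta>\<^sub>0 (u + v)) = (if \<beta> = \<beta>' then u + v else 0)"
    using add(3,4) by simp
qed

text \<open>The dual system relation for the vectors \<open>Q (g \<beta>\<^sub>0 \<beta>' u)\<close>, the ones that conjugation produces. When
  \<open>\<beta>\<close> and \<open>\<beta>'\<close> have different targets, the left side vanishes for reasons of degree; when no arrow of
  \<open>V2\<close> leads from \<open>t \<beta>\<^sub>0\<close> to their target, \<open>g \<beta>\<^sub>0 \<beta>' u\<close> is already zero.\<close>

lemma g_term:
  assumes \<beta>0: "\<beta>\<^sub>0 \<in> S" and P: "\<beta> \<in> P" "\<beta>' \<in> P" and Q: "Q \<in> End_tpow V1 m" and u: "u \<in> W2"
  shows "g \<beta>\<^sub>0 \<beta> (g' \<beta>' \<beta>\<^sub>0 (Q (g \<beta>\<^sub>0 \<beta>' u))) = (if \<beta> = \<beta>' then Q (g \<beta>\<^sub>0 \<beta> u) else 0)"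
proof -
  note b0 = S_subset[OF \<beta>0]
  have v: "Q (g \<beta>\<^sub>0 \<beta>' u) \<in> tpow V1 m (homset V1 (s \<beta>\<^sub>0) (s \<beta>'))"
    by (rule End_tpow_preserves[OF Q homset_subset_arr linear_map_in[OF g_linear[OF b0 P(2)] u]])
  have v': "Q (g \<beta>\<^sub>0 \<beta>' u) \<in> W1" by (rule tpow_homset_in_arr[OF v])
  show ?thesis
  proof (cases "t \<beta> = t \<beta>'")
    case True
    show ?thesis
    proof (cases "homset V2 (t \<beta>\<^sub>0) (t \<beta>) = {}")
      case False
      then show ?thesis using g_g'[OF \<beta>0 P True False v] by simp
    next
      case e: True
      then have "g \<beta>\<^sub>0 \<beta>' u = 0" using True u by (intro g_vanishes[OF b0 P(2) order_refl]) auto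
      then show ?thesis
        using linear_map_zero[OF End_tpow_linear[OF Q] subspace_tpow] g_zero[OF b0 P(1)] g'_zero[OF P(2) b0]
        by auto
    qed
  next
    case False
    have "g' \<beta>' \<beta>\<^sub>0 (Q (g \<beta>\<^sub>0 \<beta>' u)) \<in> tpow V2 m (homset V2 (t \<beta>\<^sub>0) (t \<beta>'))"
      by (rule linear_map_in[OF g'_linear[OF P(2) b0] v'])
    then have "g \<beta>\<^sub>0 \<beta> (g' \<beta>' \<beta>\<^sub>0 (Q (g \<beta>\<^sub>0 \<beta>' u))) = 0"
      using False by (intro g_vanishes[OF b0 P(1) homset_subset_arr]) (auto simp: homset_def)
    then show ?thesis using False by auto
  qed
qed

text \<open>\<open>P\<close> may contain infinitely many elements with given source and target, so finite type alone does not
  bound the sum that defines conjugation. But the vectors \<open>g' \<beta> \<beta>\<^sub>0 (g \<beta>\<^sub>0 \<beta> u)\<close> and the maps \<open>g \<beta>\<^sub>0 \<beta>\<close>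
  form a dual system in the finite-dimensional space of tensors of source \<open>t \<beta>\<^sub>0\<close>.\<close>

lemma finite_support:
  assumes \<beta>0: "\<beta>\<^sub>0 \<in> S" and u: "u \<in> W2"
  shows "finite {\<beta> \<in> P. g \<beta>\<^sub>0 \<beta> u \<noteq> 0}"
proof -
  note b0 = S_subset[OF \<beta>0]
  have "t \<beta>\<^sub>0 \<in> obj V2" using b0 t_onto by blast
  then obtain B where B: "finite B" "tpow V2 m (src_arrows V2 (t \<beta>\<^sub>0)) \<subseteq> fun_vs.span B"
    by (rule V2.tpow_src_arrows_finite_dim)
  have x: "g' \<beta> \<beta>\<^sub>0 (g \<beta>\<^sub>0 \<beta> u) \<in> tpow V2 m (homset V2 (t \<beta>\<^sub>0) (t \<beta>))" if "\<beta> \<in> P" for \<beta>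
    using linear_map_in[OF g'_linear[OF that b0]] g_in_W1[OF b0 that u] by blast
  let ?I = "{\<beta> \<in> P. g \<beta>\<^sub>0 \<beta> u \<noteq> 0}"
  show ?thesis
  proof (rule finite_dual_system[OF B(1), of ?I "\<lambda>\<beta>. g' \<beta> \<beta>\<^sub>0 (g \<beta>\<^sub>0 \<beta> u)" W2
        "\<lambda>\<beta>. tpow V1 m (homset V1 (s \<beta>\<^sub>0) (s \<beta>))" "g \<beta>\<^sub>0"])
    fix i assume "i \<in> ?I"
    then have i: "i \<in> P" "g \<beta>\<^sub>0 i u \<noteq> 0" by auto
    show "g' i \<beta>\<^sub>0 (g \<beta>\<^sub>0 i u) \<in> fun_vs.span B"
      by (rule subsetD[OF B(2) tpow_homset_in_src[OF x[OF i(1)]]])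
    show "g' i \<beta>\<^sub>0 (g \<beta>\<^sub>0 i u) \<in> W2"
      by (rule tpow_homset_in_arr[OF x[OF i(1)]])
    show "linear_map W2 (tpow V1 m (homset V1 (s \<beta>\<^sub>0) (s i))) (g \<beta>\<^sub>0 i)"
      by (rule g_linear[OF b0 i(1)])
    show "g \<beta>\<^sub>0 i (g' i \<beta>\<^sub>0 (g \<beta>\<^sub>0 i u)) \<noteq> 0"
      using g_term[OF \<beta>0 i(1) i(1) id_End_tpow u] i(2) by simp
    show "g \<beta>\<^sub>0 i (g' k \<beta>\<^sub>0 (g \<beta>\<^sub>0 k u)) = 0" if "k \<in> ?I" "i \<noteq> k" for k
      using g_term[OF \<beta>0 i(1) _ id_End_tpow u, of k] that by simp
  qed (rule subspace_tpow)
qed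

section \<open>Conjugation by transfer operators\<close>

text \<open>The operator \<open>(g\<inverse> *\<^sub>\<circ> (Q g))(\<beta>, \<beta>)\<close> on the part of source \<open>t \<beta>\<close>, before \<open>\<lhd>\<close> joins the parts.\<close>

definition local_conj :: "(('a1, 'v1) tensor \<Rightarrow> ('a1, 'v1) tensor) \<Rightarrow> 'p \<Rightarrow> ('a2, 'v2) tensor \<Rightarrow> ('a2, 'v2) tensor"
  where "local_conj Q \<beta> = star P g' (\<lambda>\<beta>\<^sub>1 \<beta>\<^sub>2. Q \<circ> g \<beta>\<^sub>1 \<beta>\<^sub>2) \<beta> \<beta>"

text \<open>Sums over different supports can be compared after enlarging the index set. Finiteness of
  \<open>F\<close> matters because a sum with infinite support is 0 by default.\<close>

lemma local_conj_eq_sum: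
  assumes \<beta>: "\<beta> \<in> S" and Q: "Q \<in> End_tpow V1 m"
    and F: "finite F" "F \<subseteq> P" "{\<beta>' \<in> P. g \<beta> \<beta>' u \<noteq> 0} \<subseteq> F"
  shows "local_conj Q \<beta> u = (\<Sum>\<beta>'\<in>F. g' \<beta>' \<beta> (Q (g \<beta> \<beta>' u)))"
proof -
  have "g' \<beta>' \<beta> (Q (g \<beta> \<beta>' u)) = 0" if "\<beta>' \<in> P" "g \<beta> \<beta>' u = 0" for \<beta>'
    using that linear_map_zero[OF End_tpow_linear[OF Q] subspace_tpow] g'_zero[OF that(1) S_subset[OF \<beta>]] by simp
  then show ?thesis unfolding local_conj_def star_def comp_def
    using F by (intro sum.mono_neutral_left) auto
qed

lemma local_conj_in_tpow:
  assumes \<beta>: "\<beta> \<in> S" and Q: "Q \<in> End_tpow V1 m" and u: "u \<in> W2"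
  shows "local_conj Q \<beta> u \<in> tpow V2 m (src_arrows V2 (t \<beta>))"
proof -
  have "g' \<beta>' \<beta> (Q (g \<beta> \<beta>' u)) \<in> tpow V2 m (src_arrows V2 (t \<beta>))" if "\<beta>' \<in> P" for \<beta>'
  proof -
    have "Q (g \<beta> \<beta>' u) \<in> W1"
      using End_tpow_preserves[OF Q order_refl] g_in_W1[OF S_subset[OF \<beta>] that u] by blast
    then show ?thesis
      by (rule tpow_homset_in_src[OF linear_map_in[OF g'_linear[OF that S_subset[OF \<beta>]]]])
  qed
  then show ?thesis
    unfolding local_conj_eq_sum[OF \<beta> Q finite_support[OF \<beta> u] Collect_subset order_refl]
    by (intro tpow_sum) auto
qed

lemma local_conj_add:
  assumes \<beta>: "\<beta> \<in> S" and Q: "Q \<in> End_tpow V1 m" and u: "u \<in> W2" and v: "v \<in> W2"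
  shows "local_conj Q \<beta> (u + v) = local_conj Q \<beta> u + local_conj Q \<beta> v"
proof -
  note b = S_subset[OF \<beta>]
  let ?F = "{\<beta>' \<in> P. g \<beta> \<beta>' u \<noteq> 0} \<union> {\<beta>' \<in> P. g \<beta> \<beta>' v \<noteq> 0}"
  have F: "finite ?F" "?F \<subseteq> P" using finite_support[OF \<beta>] u v by auto
  have add: "g \<beta> \<beta>' (u + v) = g \<beta> \<beta>' u + g \<beta> \<beta>' v" if "\<beta>' \<in> P" for \<beta>'
    by (rule linear_map_add[OF g_linear[OF b that] u v])
  have "local_conj Q \<beta> (u + v) = (\<Sum>\<beta>'\<in>?F. g' \<beta>' \<beta> (Q (g \<beta> \<beta>' (u + v))))"
    using F add by (intro local_conj_eq_sum[OF \<beta> Q]) auto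
  also have "\<dots> = (\<Sum>\<beta>'\<in>?F. g' \<beta>' \<beta> (Q (g \<beta> \<beta>' u)) + g' \<beta>' \<beta> (Q (g \<beta> \<beta>' v)))"
  proof (rule sum.cong[OF refl])
    fix \<beta>' assume "\<beta>' \<in> ?F"
    then have p: "\<beta>' \<in> P" by blast
    have w: "g \<beta> \<beta>' u \<in> W1" "g \<beta> \<beta>' v \<in> W1" using g_in_W1[OF b p] u v by auto
    then have "Q (g \<beta> \<beta>' u) \<in> W1" "Q (g \<beta> \<beta>' v) \<in> W1"
      using End_tpow_preserves[OF Q order_refl] by auto
    then show "g' \<beta>' \<beta> (Q (g \<beta> \<beta>' (u + v))) = g' \<beta>' \<beta> (Q (g \<beta> \<beta>' u)) + g' \<beta>' \<beta> (Q (g \<beta> \<beta>' v))"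
      using add[OF p] linear_map_add[OF End_tpow_linear[OF Q] w] linear_map_add[OF g'_linear[OF p b]] by simp
  qed
  also have "\<dots> = local_conj Q \<beta> u + local_conj Q \<beta> v"
    unfolding sum.distrib using F
    by (intro arg_cong2[of _ _ _ _ "(+)"] local_conj_eq_sum[OF \<beta> Q, symmetric]) auto
  finally show ?thesis .
qed

lemma local_conj_zero:
  assumes \<beta>: "\<beta> \<in> S" and Q: "Q \<in> End_tpow V1 m"
  shows "local_conj Q \<beta> 0 = 0"
  using local_conj_add[OF assms tpow_zero tpow_zero] by simp

text \<open>Each \<open>g \<beta> \<beta>'\<close> with \<open>\<beta> \<in> S\<close> intertwines the conjugate of \<open>Q\<close> with \<open>Q\<close>: applied to the sum over
  \<open>P\<close>, it selects the summand of \<open>\<beta>'\<close>. Multiplicativity of conjugation follows at once.\<close>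

lemma g_local_conj:
  assumes \<beta>: "\<beta> \<in> S" and \<beta>': "\<beta>' \<in> P" and Q: "Q \<in> End_tpow V1 m" and u: "u \<in> W2"
  shows "g \<beta> \<beta>' (local_conj Q \<beta> u) = Q (g \<beta> \<beta>' u)"
proof -
  note b = S_subset[OF \<beta>]
  \<comment> \<open>\<open>\<beta>'\<close> is added to the support so that the Kronecker delta has its index in the set\<close>
  let ?F = "insert \<beta>' {\<beta>' \<in> P. g \<beta> \<beta>' u \<noteq> 0}"
  have F: "finite ?F" "?F \<subseteq> P" using finite_support[OF \<beta> u] \<beta>' by auto
  have "g \<beta> \<beta>' (local_conj Q \<beta> u) = g \<beta> \<beta>' (\<Sum>b\<in>?F. g' b \<beta> (Q (g \<beta> b u)))"
    using F by (subst local_conj_eq_sum[OF \<beta> Q, of ?F]) auto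
  also have "\<dots> = (\<Sum>b\<in>?F. g \<beta> \<beta>' (g' b \<beta> (Q (g \<beta> b u))))"
    using F End_tpow_preserves[OF Q order_refl g_in_W1[OF b _ u]] g'_in_W2[OF _ b]
    by (intro linear_map_sum[OF g_linear[OF b \<beta>'] subspace_tpow]) auto
  also have "\<dots> = (\<Sum>b\<in>?F. if \<beta>' = b then Q (g \<beta> \<beta>' u) else 0)"
    using g_term[OF \<beta> \<beta>' _ Q u] F by (intro sum.cong) auto
  also have "\<dots> = Q (g \<beta> \<beta>' u)" using F(1) by (subst sum.delta') auto
  finally show ?thesis .
qed

lemma local_conj_comp:
  assumes \<beta>: "\<beta> \<in> S" and Q: "Q \<in> End_tpow V1 m" "Q' \<in> End_tpow V1 m" and u: "u \<in> W2"
  shows "local_conj Q \<beta> (local_conj Q' \<beta> u) = local_conj (Q \<circ> Q') \<beta> u"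
proof -
  let ?u = "local_conj Q' \<beta> u"
  let ?F = "{\<beta>' \<in> P. g \<beta> \<beta>' u \<noteq> 0} \<union> {\<beta>' \<in> P. g \<beta> \<beta>' ?u \<noteq> 0}"
  have u': "?u \<in> W2" by (rule tpow_src_in_arr[OF local_conj_in_tpow[OF \<beta> Q(2) u]])
  have F: "finite ?F" "?F \<subseteq> P" using finite_support[OF \<beta>] u u' by auto
  have "local_conj Q \<beta> ?u = (\<Sum>\<beta>'\<in>?F. g' \<beta>' \<beta> (Q (g \<beta> \<beta>' ?u)))"
    using F by (intro local_conj_eq_sum[OF \<beta> Q(1)]) auto
  also have "\<dots> = (\<Sum>\<beta>'\<in>?F. g' \<beta>' \<beta> ((Q \<circ> Q') (g \<beta> \<beta>' u)))"
    using F(2) g_local_conj[OF \<beta> _ Q(2) u] by (intro sum.cong) auto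
  also have "\<dots> = local_conj (Q \<circ> Q') \<beta> u"
    using F by (intro local_conj_eq_sum[OF \<beta> End_tpow_comp[OF Q], symmetric]) auto
  finally show ?thesis .
qed

lemma local_conj_cong:
  assumes \<beta>: "\<beta> \<in> S" and u: "u \<in> W2" and eq: "\<And>v. v \<in> tpow V1 m (src_arrows V1 (s \<beta>)) \<Longrightarrow> Q v = Q' v"
  shows "local_conj Q \<beta> u = local_conj Q' \<beta> u"
proof -
  have "Q (g \<beta> \<beta>' u) = Q' (g \<beta> \<beta>' u)" if "\<beta>' \<in> P" for \<beta>'
    by (rule eq[OF tpow_homset_in_src[OF linear_map_in[OF g_linear[OF S_subset[OF \<beta>] that] u]]])
  then show ?thesis unfolding local_conj_def star_def comp_def by (intro sum.cong) auto
qed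

abbreviation "Conj Q \<equiv> conj_lhd P t S V2 g' Q g"

lemma Conj_apply:
  "Conj Q u = (\<lambda>xs. if xs \<noteq> [] \<and> fst (hd xs) \<in> arr V2
     then local_conj Q (connect V2 t S (fst (hd xs))) (source_part V2 (src V2 (fst (hd xs))) u) xs else 0)"
  unfolding conj_lhd_def lhd_def local_conj_def ..

text \<open>On tensors of source \<open>t \<beta>\<close> the element of \<open>S\<close> chosen by \<open>\<lhd>\<close> is \<open>\<beta>\<close>. At argument lists of another
  source both sides vanish, because \<open>local_conj Q \<beta>\<close> keeps the source.\<close>

lemma Conj_eq_local:
  assumes \<beta>: "\<beta> \<in> S" and Q: "Q \<in> End_tpow V1 m" and u: "u \<in> tpow V2 m (src_arrows V2 (t \<beta>))"
  shows "Conj Q u = local_conj Q \<beta> u"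
proof
  fix xs
  have "u \<in> W2" by (rule tpow_src_in_arr[OF u])
  note * = V2.tpow_src_arrows_supportD[OF local_conj_in_tpow[OF \<beta> Q this], of xs]
  show "Conj Q u xs = local_conj Q \<beta> u xs"
  proof (cases "xs \<noteq> [] \<and> fst (hd xs) \<in> arr V2")
    case False
    then show ?thesis using * by (auto simp: Conj_apply)
  next
    case True
    show ?thesis
    proof (cases "src V2 (fst (hd xs)) = t \<beta>")
      case eq: True
      then show ?thesis using True connect_eq[OF \<beta>] V2.source_part_tpow[OF u] by (simp add: Conj_apply)
    next
      case False
      then have "source_part V2 (src V2 (fst (hd xs))) u = 0" using V2.source_part_tpow[OF u] by auto
      then have "Conj Q u xs = 0" using True local_conj_zero[OF _ Q] connect_in by (simp add: Conj_apply zero_fun_apply)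
      then show ?thesis using * False by auto
    qed
  qed
qed

lemma Conj_add:
  assumes Q: "Q \<in> End_tpow V1 m" and u: "u \<in> W2" and v: "v \<in> W2"
  shows "Conj Q (u + v) = Conj Q u + Conj Q v"
proof -
  have "local_conj Q (connect V2 t S \<gamma>) (source_part V2 b (u + v)) =
      local_conj Q (connect V2 t S \<gamma>) (source_part V2 b u) + local_conj Q (connect V2 t S \<gamma>) (source_part V2 b v)"
    if "\<gamma> \<in> arr V2" for \<gamma> b
  proof -
    have "source_part V2 b u \<in> W2" "source_part V2 b v \<in> W2"
      by (rule tpow_src_in_arr[OF V2.source_part_in_tpow], fact)+
    then show ?thesis using local_conj_add[OF _ Q] connect_in[OF that] by (simp add: V2.source_part_add)
  qed
  then show ?thesis by (simp add: Conj_apply fun_eq_iff plus_fun_apply)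
qed

lemma base_point:
  assumes "\<gamma> \<in> arr V2"
  obtains \<beta> where "\<beta> \<in> S" "t \<beta> = src V2 \<gamma>" "s \<beta> \<in> obj V1" "tpow V2 m {\<gamma>} \<subseteq> tpow V2 m (src_arrows V2 (t \<beta>))"
proof -
  let ?b = "connect V2 t S \<gamma>"
  have b: "?b \<in> S" "t ?b = src V2 \<gamma>" using connect_in[OF assms] by auto
  moreover have "s ?b \<in> obj V1" using S_subset[OF b(1)] s_onto by blast
  moreover have "tpow V2 m {\<gamma>} \<subseteq> tpow V2 m (src_arrows V2 (t ?b))"
    using b assms by (intro tpow_mono) (auto simp: src_arrows_def)
  ultimately show ?thesis using that by blast
qed

text \<open>Conjugation is multiplicative, although it need not preserve the identity: \<open>Conj id\<close> is only an
  idempotent in general, as \<open>g'\<close> is an inverse of \<open>g\<close> on one side.\<close>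

lemma Conj_comp:
  assumes Q: "Q \<in> End_tpow V1 m" "Q' \<in> End_tpow V1 m" and \<gamma>: "\<gamma> \<in> arr V2" and u: "u \<in> tpow V2 m {\<gamma>}"
  shows "Conj Q (Conj Q' u) = Conj (Q \<circ> Q') u"
proof -
  obtain \<beta> where \<beta>: "\<beta> \<in> S" "tpow V2 m {\<gamma>} \<subseteq> tpow V2 m (src_arrows V2 (t \<beta>))"
    using base_point[OF \<gamma>] by blast
  then have u1: "u \<in> tpow V2 m (src_arrows V2 (t \<beta>))" using u by blast
  then have u2: "u \<in> W2" by (rule tpow_src_in_arr)
  show ?thesis
    using Conj_eq_local[OF \<beta>(1)] u1 Q End_tpow_comp[OF Q] local_conj_in_tpow[OF \<beta>(1) Q(2) u2]
      local_conj_comp[OF \<beta>(1) Q u2] by simp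
qed

lemma Conj_cong:
  assumes \<beta>: "\<beta> \<in> S" and Q: "Q \<in> End_tpow V1 m" "Q' \<in> End_tpow V1 m"
    and u: "u \<in> tpow V2 m (src_arrows V2 (t \<beta>))"
    and eq: "\<And>v. v \<in> tpow V1 m (src_arrows V1 (s \<beta>)) \<Longrightarrow> Q v = Q' v"
  shows "Conj Q u = Conj Q' u"
  using Conj_eq_local[OF \<beta> Q(1) u] Conj_eq_local[OF \<beta> Q(2) u]
    local_conj_cong[OF \<beta> tpow_src_in_arr[OF u] eq] by simp

text \<open>The form in which multiplicativity meets the twist condition, which identifies the legs with conjugates
  on one degree only; that the legs preserve this degree lets the identifications be applied in turn.\<close>

lemma Conj_comp3:
  assumes A: "A \<in> End_tpow V1 m" and B: "B \<in> End_tpow V1 m" and C: "C \<in> End_tpow V1 m"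
    and eqA: "\<And>u. u \<in> tpow V2 m {\<gamma>} \<Longrightarrow> A' u = Conj A u"
    and eqB: "\<And>u. u \<in> tpow V2 m {\<gamma>} \<Longrightarrow> B' u = Conj B u"
    and eqC: "\<And>u. u \<in> tpow V2 m {\<gamma>} \<Longrightarrow> C' u = Conj C u"
    and E: "B' \<in> End_tpow V2 m" "C' \<in> End_tpow V2 m"
    and \<gamma>: "\<gamma> \<in> arr V2" and u: "u \<in> tpow V2 m {\<gamma>}"
  shows "A' (B' (C' u)) = Conj (A \<circ> B \<circ> C) u"
proof -
  have C': "C' u \<in> tpow V2 m {\<gamma>}" using \<gamma> by (intro End_tpow_preserves[OF E(2) _ u]) simp
  have B': "B' (C' u) \<in> tpow V2 m {\<gamma>}" using \<gamma> by (intro End_tpow_preserves[OF E(1) _ C']) simp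
  have "A' (B' (C' u)) = Conj A (Conj B (Conj C u))"
    using eqA[OF B'] eqB[OF C'] eqC[OF u] by simp
  also have "Conj B (Conj C u) = Conj (B \<circ> C) u" by (rule Conj_comp[OF B C \<gamma> u])
  also have "Conj A (Conj (B \<circ> C) u) = Conj (A \<circ> (B \<circ> C)) u"
    by (rule Conj_comp[OF A End_tpow_comp[OF B C] \<gamma> u])
  finally show ?thesis by (simp add: comp_assoc)
qed

text \<open>The index set of the sum depends on \<open>u\<close> but not on \<open>z\<close>, and each summand is a linear form
  of \<open>R z (g \<beta> \<beta>' u)\<close>. Here \<open>\<psi>\<close> has to be defined on all degrees, as single summands need not
  be homogeneous of the degree of \<open>u\<close>.\<close>

lemma meromorphic_local_conj:
  assumes R: "\<And>z. R z \<in> End_tpow V1 m"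
    and mero: "\<And>\<alpha> v \<phi>. \<alpha> \<in> arr V1 \<Longrightarrow> v \<in> tpow V1 m {\<alpha>} \<Longrightarrow> linear_form (tpow V1 m {\<alpha>}) \<phi> \<Longrightarrow>
      (\<lambda>z. \<phi> (R z v)) meromorphic_on UNIV"
    and \<psi>: "linear_form W2 \<psi>" and \<beta>: "\<beta> \<in> S" and u: "u \<in> W2"
  shows "(\<lambda>z. \<psi> (local_conj (R z) \<beta> u)) meromorphic_on UNIV"
proof -
  note b = S_subset[OF \<beta>]
  let ?F = "{\<beta>' \<in> P. g \<beta> \<beta>' u \<noteq> 0}"
  have F: "finite ?F" by (rule finite_support[OF \<beta> u])
  have mero1: "(\<lambda>z. \<phi> (R z v)) meromorphic_on UNIV" if \<phi>: "linear_form W1 \<phi>" and v: "v \<in> W1" for \<phi> v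
    using v
  proof (induction rule: tpow_induct_degree)
    case zero
    show "(\<lambda>z. \<phi> (R z 0)) meromorphic_on UNIV" using linear_map_zero[OF End_tpow_linear[OF R] subspace_tpow]
      by (simp add: meromorphic_on_const)
  next
    case (homogeneous \<alpha> v)
    have "linear_form (tpow V1 m {\<alpha>}) \<phi>"
      using \<phi> tpow_mono[of "{\<alpha>}" "arr V1" V1 m] homogeneous(1) unfolding linear_form_def by blast
    then show ?case using mero homogeneous by blast
  next
    case (add u v)
    have "\<phi> (R z (u + v)) = \<phi> (R z u) + \<phi> (R z v)" for z
      unfolding linear_map_add[OF End_tpow_linear[OF R] add(1,2)]
      using \<phi> End_tpow_preserves[OF R order_refl add(1)] End_tpow_preserves[OF R order_refl add(2)]
      by (simp add: linear_form_def)
    then show "(\<lambda>z. \<phi> (R z (u + v))) meromorphic_on UNIV" using add(3,4) by (simp add: meromorphic_on_add)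
  qed
  have summand: "(\<lambda>z. \<psi> (g' \<beta>' \<beta> (R z (g \<beta> \<beta>' u)))) meromorphic_on UNIV" if p: "\<beta>' \<in> P" for \<beta>'
  proof (rule mero1[of "\<lambda>v. \<psi> (g' \<beta>' \<beta> v)"])
    show "linear_form W1 (\<lambda>v. \<psi> (g' \<beta>' \<beta> v))"
      using \<psi> linear_map_add[OF g'_linear[OF p b]] linear_map_scale[OF g'_linear[OF p b]] g'_in_W2[OF p b]
      by (simp add: linear_form_def)
  qed (rule g_in_W1[OF b p u])
  have sum: "\<psi> (sum x I) = (\<Sum>i\<in>I. \<psi> (x i))" if "finite I" "\<And>i. i \<in> I \<Longrightarrow> x i \<in> W2" for x I
    using that
  proof (induction I)
    case empty
    have "\<psi> (tscale 0 0) = 0 * \<psi> 0" using \<psi> tpow_zero unfolding linear_form_def by blast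
    then show ?case by (simp add: fun_vs.scale_zero_left)
  next
    case (insert i I)
    then have "\<psi> (x i + sum x I) = \<psi> (x i) + \<psi> (sum x I)"
      using \<psi> tpow_sum[of I x V2 m "arr V2"] unfolding linear_form_def by blast
    then show ?case using insert by simp
  qed
  have "\<psi> (local_conj (R z) \<beta> u) = (\<Sum>\<beta>'\<in>?F. \<psi> (g' \<beta>' \<beta> (R z (g \<beta> \<beta>' u))))" for z
    unfolding local_conj_eq_sum[OF \<beta> R F Collect_subset order_refl]
    using End_tpow_preserves[OF R order_refl] g_in_W1[OF b _ u] g'_in_W2[OF _ b] by (intro sum[OF F]) auto
  then show ?thesis using summand by (auto intro!: meromorphic_on_sum)
qed

end

section \<open>The Yang--Baxter operator of a twist\<close>

theorem proposition4p10:
  fixes V1 :: "('o1, 'a1, 'v1::ab_group_add) graded"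
    and V2 :: "('o2, 'a2, 'v2::ab_group_add) graded"
    and P S :: "'p set" and s :: "'p \<Rightarrow> 'o1" and t :: "'p \<Rightarrow> 'o2"
    and R1 :: "complex \<Rightarrow> ('a1, 'v1) tensor \<Rightarrow> ('a1, 'v1) tensor"
    and R2 :: "complex \<Rightarrow> ('a2, 'v2) tensor \<Rightarrow> ('a2, 'v2) tensor"
    and j :: "'p \<Rightarrow> 'p \<Rightarrow> ('a2, 'v2) tensor \<Rightarrow> ('a1, 'v1) tensor"
    and j' :: "'p \<Rightarrow> 'p \<Rightarrow> ('a1, 'v1) tensor \<Rightarrow> ('a2, 'v2) tensor"
  defines "R2 \<equiv> \<lambda>z. conj_lhd P t S V2 j' (R1 z) j"
  assumes "graded_space V1" and "graded_space V2"
    and "s ` P = obj V1" and "t ` P = obj V2"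
    and "yang_baxter_operator V1 R1"
    and "unique_connecting_system P s t V2 S"
    and "right_inverse P s t 2 V1 V2 j j'"
    and R2_End: "\<And>z. R2 z \<in> End_tpow V2 2"
    and "is_twist P s t S V1 V2 R1 j j'"
  shows "meromorphic_End V2 R2 \<and> yang_baxter_equation V2 R2 \<and>
    (yang_baxter_operator V2 R2 \<longleftrightarrow>
      (\<forall>u\<in>tpow V2 2 (arr V2). conj_lhd P t S V2 j' id j u = u))"
proof -
  obtain q q' where q: "right_inverse P s t 3 V1 V2 q q'"
    and twist: "\<And>\<gamma>. \<gamma> \<in> arr V2 \<Longrightarrow> \<forall>\<^sub>F z in cosparse UNIV. \<forall>u\<in>tpow V2 3 {\<gamma>}.
      leg23 (R2 z) u = conj_lhd P t S V2 q' (leg23 (R1 z)) q u \<and>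
      leg12 (R2 z) u = conj_lhd P t S V2 q' (leg12 (R1 z)) q u"
    using \<open>is_twist P s t S V1 V2 R1 j j'\<close> unfolding is_twist_def R2_def by blast
  interpret V1: graded_space V1 by fact
  interpret V2: graded_space V2 by fact
  interpret T2: unique_transfer V1 V2 P S s t 2 j j' by unfold_locales fact+
  interpret T3: unique_transfer V1 V2 P S s t 3 q q' by unfold_locales fact+
  have R2: "R2 z = T2.Conj (R1 z)" for z by (simp add: R2_def)
  have R1: "meromorphic_End V1 R1" "yang_baxter_equation V1 R1" "inversion_relation V1 R1"
    using \<open>yang_baxter_operator V1 R1\<close> by (auto simp: yang_baxter_operator_def)
  have R1_End: "R1 z \<in> End_tpow V1 2" for z using R1(1) by (simp add: meromorphic_End_def)
  note legs1 = V1.leg12_End[OF R1_End] V1.leg23_End[OF R1_End]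
  note legs2 = V2.leg12_End[OF R2_End] V2.leg23_End[OF R2_End]

  have mero: "meromorphic_End V2 R2"
    unfolding meromorphic_End_def
  proof (intro conjI allI ballI impI R2_End)
    fix \<gamma> u \<phi>
    assume \<gamma>: "\<gamma> \<in> arr V2" and u: "u \<in> tpow V2 2 {\<gamma>}" and \<phi>: "linear_form (tpow V2 2 {\<gamma>}) \<phi>"
    obtain \<beta> where \<beta>: "\<beta> \<in> S" "tpow V2 2 {\<gamma>} \<subseteq> tpow V2 2 (src_arrows V2 (t \<beta>))"
      using T2.base_point[OF \<gamma>] by metis
    have u1: "u \<in> tpow V2 2 (src_arrows V2 (t \<beta>))" using u \<beta>(2) by blast
    \<comment> \<open>\<open>\<phi>\<close> is known to be linear in degree \<open>\<gamma>\<close> only, so it is composed with the projection to that degree\<close>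
    have "R2 z u \<in> tpow V2 2 {\<gamma>}" for z using \<gamma> by (intro End_tpow_preserves[OF R2_End _ u]) simp
    then have "\<phi> (R2 z u) = \<phi> (V2.degree_part \<gamma> (T2.local_conj (R1 z) \<beta> u))" for z
      using V2.degree_part_id T2.Conj_eq_local[OF \<beta>(1) R1_End u1] R2 by metis
    moreover have "(\<lambda>z. \<phi> (V2.degree_part \<gamma> (T2.local_conj (R1 z) \<beta> u))) meromorphic_on UNIV"
    proof (rule T2.meromorphic_local_conj[OF R1_End])
      show "linear_form (tpow V2 2 (arr V2)) (\<lambda>v. \<phi> (V2.degree_part \<gamma> v))"
        using \<phi> V2.degree_part_in_tpow[of _ 2 "arr V2" \<gamma>] unfolding linear_form_def
        by (simp add: V2.degree_part_linear)
      show "\<beta> \<in> S" by fact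
      show "u \<in> tpow V2 2 (arr V2)" by (rule tpow_src_in_arr[OF u1])
    qed (use R1(1) in \<open>auto simp: meromorphic_End_def\<close>)
    ultimately show "(\<lambda>z. \<phi> (R2 z u)) meromorphic_on UNIV" by simp
  qed

  have ybe: "yang_baxter_equation V2 R2"
    unfolding yang_baxter_equation_def
  proof (intro ballI)
    fix \<gamma> assume \<gamma>: "\<gamma> \<in> arr V2"
    obtain \<beta> where \<beta>: "\<beta> \<in> S" "s \<beta> \<in> obj V1" "tpow V2 3 {\<gamma>} \<subseteq> tpow V2 3 (src_arrows V2 (t \<beta>))"
      using T3.base_point[OF \<gamma>] by metis
    obtain A where A: "finite A" "A \<subseteq> src_arrows V1 (s \<beta>)" "tpow V1 3 (src_arrows V1 (s \<beta>)) = tpow V1 3 A"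
      by (rule V1.tpow_src_arrows_support[OF \<beta>(2)])
    have A_arr: "A \<subseteq> arr V1" using A(2) by (auto simp: src_arrows_def)
    have "\<forall>\<alpha>\<in>arr V1. \<exists>E. E sparse_in UNIV \<and> (\<forall>z w. z \<notin> E \<and> w \<notin> E \<and> z - w \<notin> E \<longrightarrow>
        (\<forall>v\<in>tpow V1 3 {\<alpha>}. leg23 (R1 (z - w)) (leg12 (R1 z) (leg23 (R1 w) v)) =
           leg12 (R1 w) (leg23 (R1 z) (leg12 (R1 (z - w)) v))))"
      using R1(2) by (simp add: yang_baxter_equation_def)
    then obtain E where E: "\<And>\<alpha>. \<alpha> \<in> arr V1 \<Longrightarrow> E \<alpha> sparse_in UNIV"
      and E_ybe: "\<And>\<alpha> z w v. \<alpha> \<in> arr V1 \<Longrightarrow> z \<notin> E \<alpha> \<Longrightarrow> w \<notin> E \<alpha> \<Longrightarrow> z - w \<notin> E \<alpha> \<Longrightarrow> v \<in> tpow V1 3 {\<alpha>} \<Longrightarrow>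
        leg23 (R1 (z - w)) (leg12 (R1 z) (leg23 (R1 w) v)) =
        leg12 (R1 w) (leg23 (R1 z) (leg12 (R1 (z - w)) v))"
      by metis
    \<comment> \<open>the parameters at which the twist condition fails in degree \<open>\<gamma>\<close>\<close>
    define E0 where "E0 = {z. \<not> (\<forall>u\<in>tpow V2 3 {\<gamma>}. leg23 (R2 z) u = T3.Conj (leg23 (R1 z)) u \<and>
      leg12 (R2 z) u = T3.Conj (leg12 (R1 z)) u)}"
    have "E0 sparse_in UNIV" using twist[OF \<gamma>] by (simp add: eventually_cosparse E0_def)
    moreover have "(\<Union>\<alpha>\<in>A. E \<alpha>) sparse_in UNIV"
      using A(1) A_arr E by (intro sparse_in_UN_finite) auto
    ultimately have "(E0 \<union> (\<Union>\<alpha>\<in>A. E \<alpha>)) sparse_in UNIV" by (rule sparse_in_union')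
    moreover have "leg23 (R2 (z - w)) (leg12 (R2 z) (leg23 (R2 w) u)) =
        leg12 (R2 w) (leg23 (R2 z) (leg12 (R2 (z - w)) u))"
      if z: "z \<notin> E0 \<union> (\<Union>\<alpha>\<in>A. E \<alpha>)" and w: "w \<notin> E0 \<union> (\<Union>\<alpha>\<in>A. E \<alpha>)"
        and zw: "z - w \<notin> E0 \<union> (\<Union>\<alpha>\<in>A. E \<alpha>)" and u: "u \<in> tpow V2 3 {\<gamma>}" for z w u
    proof -
      have tw: "leg23 (R2 x) u = T3.Conj (leg23 (R1 x)) u" "leg12 (R2 x) u = T3.Conj (leg12 (R1 x)) u"
        if "x \<notin> E0" "u \<in> tpow V2 3 {\<gamma>}" for x u using that by (auto simp: E0_def)
      have n: "z \<notin> E0" "w \<notin> E0" "z - w \<notin> E0" using z w zw by auto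
      let ?L = "leg23 (R1 (z - w)) \<circ> leg12 (R1 z) \<circ> leg23 (R1 w)"
      let ?R = "leg12 (R1 w) \<circ> leg23 (R1 z) \<circ> leg12 (R1 (z - w))"
      have LR: "?L \<in> End_tpow V1 3" "?R \<in> End_tpow V1 3" by (intro End_tpow_comp legs1)+
      have "leg23 (R2 (z - w)) (leg12 (R2 z) (leg23 (R2 w) u)) = T3.Conj ?L u"
        by (rule T3.Conj_comp3[OF legs1(2) legs1(1) legs1(2) _ _ _ legs2(1) legs2(2) \<gamma> u]) (rule tw n | assumption)+
      also have "\<dots> = T3.Conj ?R u"
      proof (rule T3.Conj_cong[OF \<beta>(1) LR])
        show "u \<in> tpow V2 3 (src_arrows V2 (t \<beta>))" using u \<beta>(3) by blast
        fix v assume "v \<in> tpow V1 3 (src_arrows V1 (s \<beta>))"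
        then have "v \<in> tpow V1 3 A" using A(3) by simp
        then show "?L v = ?R v"
        proof (rule End_tpow_eq_on[OF LR A_arr, rotated])
          fix \<alpha> v assume "\<alpha> \<in> A" "v \<in> tpow V1 3 {\<alpha>}"
          then show "?L v = ?R v" using E_ybe[of \<alpha> z w v] A_arr z w zw by auto
        qed
      qed
      also have "T3.Conj ?R u = leg12 (R2 w) (leg23 (R2 z) (leg12 (R2 (z - w)) u))"
        by (rule T3.Conj_comp3[OF legs1(1) legs1(2) legs1(1) _ _ _ legs2(2) legs2(1) \<gamma> u, symmetric])
          (rule tw n | assumption)+
      finally show ?thesis .
    qed
    ultimately show "\<exists>E. E sparse_in UNIV \<and> (\<forall>z w. z \<notin> E \<and> w \<notin> E \<and> z - w \<notin> E \<longrightarrow>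
      (\<forall>u\<in>tpow V2 3 {\<gamma>}. leg23 (R2 (z - w)) (leg12 (R2 z) (leg23 (R2 w) u)) =
         leg12 (R2 w) (leg23 (R2 z) (leg12 (R2 (z - w)) u))))"
      by (intro exI[of _ "E0 \<union> (\<Union>\<alpha>\<in>A. E \<alpha>)"] conjI allI impI ballI) (assumption | elim conjE)+
  qed

  \<comment> \<open>multiplicativity and the inversion relation of \<open>R1\<close> give the idempotent \<open>Conj id\<close>\<close>
  have inv: "\<forall>\<^sub>F z in cosparse UNIV. \<forall>u\<in>tpow V2 2 {\<gamma>}. R2 z (R2 (- z) u) = T2.Conj id u"
    if \<gamma>: "\<gamma> \<in> arr V2" for \<gamma>
  proof -
    obtain \<beta> where \<beta>: "\<beta> \<in> S" "s \<beta> \<in> obj V1" "tpow V2 2 {\<gamma>} \<subseteq> tpow V2 2 (src_arrows V2 (t \<beta>))"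
      using T2.base_point[OF \<gamma>] by metis
    obtain A where A: "finite A" "A \<subseteq> src_arrows V1 (s \<beta>)" "tpow V1 2 (src_arrows V1 (s \<beta>)) = tpow V1 2 A"
      by (rule V1.tpow_src_arrows_support[OF \<beta>(2)])
    have A_arr: "A \<subseteq> arr V1" using A(2) by (auto simp: src_arrows_def)
    have "\<forall>\<^sub>F z in cosparse UNIV. \<forall>\<alpha>\<in>A. \<forall>v\<in>tpow V1 2 {\<alpha>}. R1 z (R1 (- z) v) = v"
      using R1(3) A_arr by (intro eventually_ball_finite[OF A(1)]) (auto simp: inversion_relation_def)
    then show ?thesis
    proof eventually_elim
      case (elim z)
      have RR: "R1 z \<circ> R1 (- z) \<in> End_tpow V1 2" by (intro End_tpow_comp R1_End)
      show ?case
      proof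
        fix u assume u: "u \<in> tpow V2 2 {\<gamma>}"
        have "R2 z (R2 (- z) u) = T2.Conj (R1 z \<circ> R1 (- z)) u"
          unfolding R2 by (rule T2.Conj_comp[OF R1_End R1_End \<gamma> u])
        also have "\<dots> = T2.Conj id u"
        proof (rule T2.Conj_cong[OF \<beta>(1) RR id_End_tpow])
          show "u \<in> tpow V2 2 (src_arrows V2 (t \<beta>))" using u \<beta>(3) by blast
          fix v assume "v \<in> tpow V1 2 (src_arrows V1 (s \<beta>))"
          then have "v \<in> tpow V1 2 A" using A(3) by simp
          then show "(R1 z \<circ> R1 (- z)) v = id v"
            by (rule End_tpow_eq_on[OF RR id_End_tpow A_arr, rotated]) (use elim in auto)
        qed
        finally show "R2 z (R2 (- z) u) = T2.Conj id u" .
      qed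
    qed
  qed

  have "inversion_relation V2 R2 \<longleftrightarrow> (\<forall>u\<in>tpow V2 2 (arr V2). T2.Conj id u = u)"
  proof
    assume inversion: "inversion_relation V2 R2"
    have homogeneous: "T2.Conj id u = u" if \<gamma>: "\<gamma> \<in> arr V2" and u: "u \<in> tpow V2 2 {\<gamma>}" for \<gamma> u
    proof -
      have "\<forall>\<^sub>F z in cosparse UNIV. \<forall>u\<in>tpow V2 2 {\<gamma>}. R2 z (R2 (- z) u) = u"
        using inversion \<gamma> by (simp add: inversion_relation_def)
      \<comment> \<open>two generic statements hold at a common \<open>z\<close>, and the resulting equation is independent of \<open>z\<close>\<close>
      then have "\<forall>\<^sub>F z :: complex in cosparse UNIV. T2.Conj id u = u"
        using inv[OF \<gamma>] by eventually_elim (use u in auto)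
      then show ?thesis by (simp add: eventually_const_iff)
    qed
    have zero: "T2.Conj id 0 = 0" using T2.Conj_add[OF id_End_tpow tpow_zero tpow_zero] by simp
    show "\<forall>u\<in>tpow V2 2 (arr V2). T2.Conj id u = u"
    proof
      fix u assume "u \<in> tpow V2 2 (arr V2)"
      then show "T2.Conj id u = u"
      proof (induction rule: tpow_induct_degree)
        case zero
        show "T2.Conj id 0 = 0" by fact
      next
        case (add u v)
        show "T2.Conj id (u + v) = u + v" using T2.Conj_add[OF id_End_tpow add(1,2)] add(3,4) by simp
      qed (rule homogeneous)
    qed
  next
    assume id: "\<forall>u\<in>tpow V2 2 (arr V2). T2.Conj id u = u"
    show "inversion_relation V2 R2"
      unfolding inversion_relation_def
    proof
      fix \<gamma> assume \<gamma>: "\<gamma> \<in> arr V2"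
      have "tpow V2 2 {\<gamma>} \<subseteq> tpow V2 2 (arr V2)" using \<gamma> by (intro tpow_mono) simp
      with inv[OF \<gamma>] id show "\<forall>\<^sub>F z in cosparse UNIV. \<forall>u\<in>tpow V2 2 {\<gamma>}. R2 z (R2 (- z) u) = u"
        by (auto elim!: eventually_mono)
    qed
  qed
  with mero ybe show ?thesis by (simp add: yang_baxter_operator_def)
qed

end
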